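(* Let $W$ be a $1|2$-dimensional $\mathbb{Z}_2$-graded vector space over $\mathfrak K$, and let $d=d_1+d_2+\cdots$ with $d_i\in L_i$ be a codifferential on $W$ with $d_1\neq 0$. Then $d$ is equivalent to exactly one of the two codifferentials $\psi^{0,1,0}_3$ and $\psi^{0,0,1}_1$ (both lying in $L_1$).
   Context: $\mathfrak K$ is an algebraically closed field of characteristic zero. $W=\langle w_1,w_2,w_3\rangle$ is the $\mathbb{Z}_2$-graded vector space with $w_1,w_2$ odd and $w_3$ even. $S(W)=\bigoplus_{n\ge1}S^n(W)$ is the reduced $\mathbb{Z}_2$-graded symmetric algebra (with $uv=(-1)^{uv}vu$), with its coalgebra structure $\Delta(v_1\cdots v_n)=\sum_{k=1}^{n-1}\sum_{\sigma\in \mathrm{Sh}(k,n-k)}\epsilon(\sigma)\,v_{\sigma(1)}\cdots v_{\sigma(k)}\otimes v_{\sigma(k+1)}\cdots v_{\sigma(n)}$, where $\mathrm{Sh}(k,n-k)$ is the set of unshuffles and $\epsilon(\sigma)$ is the sign with $v_{\sigma(1)}\cdots v_{\sigma(n)}=\epsilon(\sigma)v_1\cdots v_n$. Put $L_n=\mathrm{Hom}(S^n(W),W)$ and $L=\mathrm{Hom}(S(W),W)=\prod_{n\ge1} L_n$. Each $\varphi\in L_k$ extends to a coderivation $\tilde\varphi$ of $S(W)$ by $\tilde\varphi(v_1\cdots v_n)=\sum_{\sigma\in\mathrm{Sh}(k,n-k)}\epsilon(\sigma)\varphi(v_{\sigma(1)}\cdots v_{\sigma(k)})v_{\sigma(k+1)}\cdots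 v_{\sigma(n)}$, and this identifies $L$ with the coderivations of $S(W)$. The bracket on $L$ is $[\alpha,\beta]=\alpha\tilde\beta-(-1)^{\alpha\beta}\beta\tilde\alpha$. A codifferential (an $L_\infty$ structure on $W$, in the parity-reversed convention) is an odd element $d\in L$ with $[d,d]=0$, equivalently $\tilde d^2=0$. Two codifferentials $d,d'$ are equivalent if there is a parity-preserving coalgebra automorphism $\tilde g$ of $S(W)$ (determined by $g=g_1+g_2+\cdots\in L$, $g_i:S^i(W)\to W$ even, $g_1$ invertible) with $d'=\tilde g^{-1}\circ d\circ\tilde g$. For $I=(i_1,i_2,i_3)$ with $i_1,i_2\in\{0,1\}$, $i_3\ge0$ and $|I|=i_1+i_2+i_3\ge1$, let $w_I=w_1^{i_1}w_2^{i_2}w_3^{i_3}$ and $I!=i_1!i_2!i_3!$. The element $\varphi^I_j\in L_{|I|}$ is defined by $\varphi^I_j(w_J)=I!\,\delta^I_J\,w_j$. It is written $\psi^I_j$ when it is odd. *)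

theory Defs
  imports
    Complex_Main
    "HOL-Library.Poly_Mapping"
    "HOL-Library.Z2"
    "HOL-Combinatorics.Permutations"
    "HOL-Computational_Algebra.Polynomial"
begin

section \<open>Free vector spaces\<close>

text \<open>\<open>'b \<Rightarrow>\<^sub>0 'k\<close> is the \<open>'k\<close>-vector space with basis \<open>basis b\<close>, \<open>b :: 'b\<close>.\<close>

definition scal :: "'k::field \<Rightarrow> ('b \<Rightarrow>\<^sub>0 'k) \<Rightarrow> ('b \<Rightarrow>\<^sub>0 'k)" where
  "scal c x = Poly_Mapping.map ((*) c) x"

lemma lookup_scal [simp]: "Poly_Mapping.lookup (scal c x) b = c * Poly_Mapping.lookup x b"
  by (simp add: scal_def Poly_Mapping.map.rep_eq Poly_Mapping.when_def)

lemma vector_space_scal: "vector_space (scal :: 'k::field \<Rightarrow> ('b \<Rightarrow>\<^sub>0 'k) \<Rightarrow> ('b \<Rightarrow>\<^sub>0 'k))"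
  by unfold_locales (auto intro!: poly_mapping_eqI simp: lookup_add algebra_simps)

abbreviation lin :: "(('a \<Rightarrow>\<^sub>0 'k::field) \<Rightarrow> ('b \<Rightarrow>\<^sub>0 'k)) \<Rightarrow> bool" where
  "lin f \<equiv> Vector_Spaces.linear scal scal f"

abbreviation basis :: "'b \<Rightarrow> ('b \<Rightarrow>\<^sub>0 'k::field)" where
  "basis b \<equiv> Poly_Mapping.single b 1"

definition lin_ext :: "('a \<Rightarrow> ('b \<Rightarrow>\<^sub>0 'k::field)) \<Rightarrow> ('a \<Rightarrow>\<^sub>0 'k) \<Rightarrow> ('b \<Rightarrow>\<^sub>0 'k)" where
  "lin_ext f x = (\<Sum>b\<in>Poly_Mapping.keys x. scal (Poly_Mapping.lookup x b) (f b))"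

lemma lin_ext_superset:
  assumes "finite A" "Poly_Mapping.keys x \<subseteq> A"
  shows "lin_ext f x = (\<Sum>b\<in>A. scal (Poly_Mapping.lookup x b) (f b))"
  unfolding lin_ext_def using assms
  by (intro sum.mono_neutral_left)
     (auto intro!: poly_mapping_eqI simp: in_keys_iff)

lemma lin_ext_basis [simp]: "lin_ext f (basis b) = f b"
  by (auto intro!: poly_mapping_eqI simp: lin_ext_def)

lemma lin_lin_ext: "lin (lin_ext f)"
proof -
  interpret v1: vector_space "scal :: 'a \<Rightarrow> ('b \<Rightarrow>\<^sub>0 'a) \<Rightarrow> _" by (rule vector_space_scal)
  interpret v2: vector_space "scal :: 'a \<Rightarrow> ('c \<Rightarrow>\<^sub>0 'a) \<Rightarrow> _" by (rule vector_space_scal)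
  have add: "lin_ext f (x + y) = lin_ext f x + lin_ext f y" for x y
  proof -
    let ?A = "Poly_Mapping.keys x \<union> Poly_Mapping.keys y"
    have k: "Poly_Mapping.keys (x + y) \<subseteq> ?A" by (rule Poly_Mapping.keys_add)
    show ?thesis
      using k by (simp add: lin_ext_superset[of ?A] lookup_add v2.scale_left_distrib sum.distrib)
  qed
  have scale: "lin_ext f (scal c x) = scal c (lin_ext f x)" for c x
  proof -
    have "Poly_Mapping.keys (scal c x) \<subseteq> Poly_Mapping.keys x" by (auto simp: in_keys_iff)
    then show ?thesis
      by (simp add: lin_ext_superset[of "Poly_Mapping.keys x"] v2.scale_sum_right)
  qed
  show ?thesis by unfold_locales (auto simp: add scale)
qed

text \<open>The tensor product of the spaces with bases \<open>'a\<close> and \<open>'b\<close> is the space with basis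
  \<open>'a \<times> 'b\<close>.\<close>

definition tensor :: "('a \<Rightarrow>\<^sub>0 'k::field) \<Rightarrow> ('b \<Rightarrow>\<^sub>0 'k) \<Rightarrow> ('a \<times> 'b \<Rightarrow>\<^sub>0 'k)" where
  "tensor x y =
     (\<Sum>a\<in>Poly_Mapping.keys x. \<Sum>b\<in>Poly_Mapping.keys y. Poly_Mapping.single (a, b) (Poly_Mapping.lookup x a * Poly_Mapping.lookup y b))"

text \<open>No Koszul sign appears: this is only used for even \<open>f\<close> and \<open>g\<close>.\<close>

definition tensor_map ::
  "(('a \<Rightarrow>\<^sub>0 'k::field) \<Rightarrow> ('c \<Rightarrow>\<^sub>0 'k)) \<Rightarrow> (('b \<Rightarrow>\<^sub>0 'k) \<Rightarrow> ('d \<Rightarrow>\<^sub>0 'k)) \<Rightarrow>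
   ('a \<times> 'b \<Rightarrow>\<^sub>0 'k) \<Rightarrow> ('c \<times> 'd \<Rightarrow>\<^sub>0 'k)" where
  "tensor_map f g = lin_ext (\<lambda>(a, b). tensor (f (basis a)) (g (basis b)))"

text \<open>Parities live in \<open>\<int>/2\<close> (type \<open>bit\<close>, \<open>1\<close> = odd); \<open>p\<close> assigns parities to basis
  vectors. The map \<open>f\<close> is homogeneous of parity \<open>e\<close> if it shifts parities by \<open>e\<close>.\<close>

definition homog :: "('b \<Rightarrow> bit) \<Rightarrow> bit \<Rightarrow> ('b \<Rightarrow>\<^sub>0 'k::field) set" where
  "homog p e = {x. \<forall>b\<in>Poly_Mapping.keys x. p b = e}"

definition has_parity :: "('a \<Rightarrow> bit) \<Rightarrow> ('b \<Rightarrow> bit) \<Rightarrow> bit \<Rightarrow>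
    (('a \<Rightarrow>\<^sub>0 'k::field) \<Rightarrow> ('b \<Rightarrow>\<^sub>0 'k)) \<Rightarrow> bool" where
  "has_parity p q e f \<longleftrightarrow> (\<forall>c. \<forall>x\<in>homog p c. f x \<in> homog q (c + e))"

definition ksign :: "bit \<Rightarrow> bit \<Rightarrow> 'k::field" where
  "ksign p q = (if p * q = 1 then -1 else 1)"


section \<open>The space \<open>W\<close> and its reduced symmetric algebra\<close>

datatype gen = W1 | W2 | W3

type_synonym 'k vecW = "gen \<Rightarrow>\<^sub>0 'k"

fun gpar :: "gen \<Rightarrow> bit" where
  "gpar W1 = 1" | "gpar W2 = 1" | "gpar W3 = 0"

fun gidx :: "gen \<Rightarrow> nat" where
  "gidx W1 = 1" | "gidx W2 = 2" | "gidx W3 = 3"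

text \<open>Multi-indices \<open>I\<close> of the basis \<open>w_I\<close> of \<open>S(W)\<close>.\<close>

typedef mono = "{(i1 :: nat, i2 :: nat, i3 :: nat). i1 \<le> 1 \<and> i2 \<le> 1 \<and> 1 \<le> i1 + i2 + i3}"
  by (rule exI[of _ "(0, 0, 1)"]) simp

type_synonym 'k symW = "mono \<Rightarrow>\<^sub>0 'k"

definition mdeg :: "mono \<Rightarrow> nat" where
  "mdeg I = (case Rep_mono I of (i1, i2, i3) \<Rightarrow> i1 + i2 + i3)"

definition mpar :: "mono \<Rightarrow> bit" where
  "mpar I = (case Rep_mono I of (i1, i2, i3) \<Rightarrow> of_nat (i1 + i2))"

text \<open>The factors of \<open>w_I\<close>, in order.\<close>

definition mword :: "mono \<Rightarrow> gen list" where
  "mword I = (case Rep_mono I of (i1, i2, i3) \<Rightarrow>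
     replicate i1 W1 @ replicate i2 W2 @ replicate i3 W3)"

text \<open>The product in \<open>S(W)\<close> of a nonempty word of generators: sorting it by the rule
  \<open>u v = (-1)^{uv} v u\<close> produces one Koszul sign per inversion, and words with a repeated
  odd generator vanish.\<close>

definition wprod :: "gen list \<Rightarrow> 'k::field symW" where
  "wprod xs =
     (if xs \<noteq> [] \<and> count_list xs W1 \<le> 1 \<and> count_list xs W2 \<le> 1
      then Poly_Mapping.single
             (Abs_mono (count_list xs W1, count_list xs W2, count_list xs W3))
             (\<Prod>(i, j) \<in> {(i, j). i < j \<and> j < length xs \<and> gidx (xs ! j) < gidx (xs ! i)}.
                ksign (gpar (xs ! i)) (gpar (xs ! j)))
      else 0)"

text \<open>Left multiplication \<open>u \<mapsto> u v_1 \<dots> v_m\<close> for \<open>u\<close> in \<open>W\<close>.\<close>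

definition wmult :: "'k::field vecW \<Rightarrow> gen list \<Rightarrow> 'k symW" where
  "wmult u xs = lin_ext (\<lambda>j. wprod (j # xs)) u"


section \<open>Coalgebra structure and coderivations\<close>

text \<open>\<open>Sh(k, n - k)\<close>, acting on positions \<open>0, \<dots>, n - 1\<close>.\<close>

definition unshuffles :: "nat \<Rightarrow> nat \<Rightarrow> (nat \<Rightarrow> nat) set" where
  "unshuffles k n =
     {\<sigma>. \<sigma> permutes {..<n} \<and> strict_mono_on {..<k} \<sigma> \<and> strict_mono_on {k..<n} \<sigma>}"

definition koszul :: "gen list \<Rightarrow> (nat \<Rightarrow> nat) \<Rightarrow> 'k::field" where
  "koszul v \<sigma> =
     (\<Prod>(i, j) \<in> {(i, j). i < j \<and> j < length v \<and> \<sigma> j < \<sigma> i}.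
        ksign (gpar (v ! \<sigma> i)) (gpar (v ! \<sigma> j)))"

definition comult :: "'k::field symW \<Rightarrow> (mono \<times> mono \<Rightarrow>\<^sub>0 'k)" where
  "comult = lin_ext (\<lambda>I. let v = mword I; n = length v in
     \<Sum>k\<in>{1..<n}. \<Sum>\<sigma>\<in>unshuffles k n.
       scal (koszul v \<sigma>)
         (tensor (wprod (map (\<lambda>i. v ! \<sigma> i) [0..<k])) (wprod (map (\<lambda>i. v ! \<sigma> i) [k..<n]))))"

text \<open>An element of \<open>L = Hom(S(W), W)\<close> is a linear map \<open>\<phi>\<close>; its component in \<open>L_n\<close> is regarded
  as a map on all of \<open>S(W)\<close> which vanishes on the other \<open>S^m(W)\<close>.\<close>

type_synonym 'k cochain = "'k symW \<Rightarrow> 'k vecW"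

definition component :: "nat \<Rightarrow> 'k::field cochain \<Rightarrow> 'k cochain" where
  "component n \<phi> = lin_ext (\<lambda>I. if mdeg I = n then \<phi> (basis I) else 0)"

text \<open>The coderivation extending \<open>\<phi>\<close>, summed over the components \<open>\<phi>_k\<close> of \<open>\<phi>\<close>; those with
  \<open>k > n\<close> do not contribute on \<open>S^n(W)\<close>.\<close>

definition coder :: "'k::field cochain \<Rightarrow> 'k symW \<Rightarrow> 'k symW" where
  "coder \<phi> = lin_ext (\<lambda>I. let v = mword I; n = length v in
     \<Sum>k\<in>{1..n}. \<Sum>\<sigma>\<in>unshuffles k n.
       scal (koszul v \<sigma>)
         (wmult (component k \<phi> (wprod (map (\<lambda>i. v ! \<sigma> i) [0..<k])))
            (map (\<lambda>i. v ! \<sigma> i) [k..<n])))"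

text \<open>\<open>[\<alpha>, \<beta>]\<close> for homogeneous \<open>\<alpha>\<close>, \<open>\<beta>\<close> of parities \<open>p\<close>, \<open>q\<close>.\<close>

definition bracket :: "bit \<Rightarrow> bit \<Rightarrow> 'k::field cochain \<Rightarrow> 'k cochain \<Rightarrow> 'k cochain" where
  "bracket p q \<alpha> \<beta> x = \<alpha> (coder \<beta> x) - scal (ksign p q) (\<beta> (coder \<alpha> x))"

definition codifferential :: "'k::field cochain \<Rightarrow> bool" where
  "codifferential d \<longleftrightarrow>
     lin d \<and> has_parity mpar gpar 1 d \<and> (\<forall>x. bracket 1 1 d d x = 0)"

definition coalgebra_automorphism :: "('k::field symW \<Rightarrow> 'k symW) \<Rightarrow> bool" where
  "coalgebra_automorphism g \<longleftrightarrow>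
     lin g \<and> bij g \<and> has_parity mpar mpar 0 g \<and>
     (\<forall>x. comult (g x) = tensor_map g g (comult x))"

definition equivalent :: "'k::field cochain \<Rightarrow> 'k cochain \<Rightarrow> bool" where
  "equivalent d d' \<longleftrightarrow> codifferential d \<and> codifferential d' \<and>
     (\<exists>g. coalgebra_automorphism g \<and> coder d' = inv g \<circ> coder d \<circ> g)"

text \<open>\<open>\<phi>^I_j\<close>; written \<open>\<psi>^I_j\<close> when it is odd.\<close>

definition phi :: "nat \<times> nat \<times> nat \<Rightarrow> gen \<Rightarrow> 'k::field cochain" where
  "phi I j = lin_ext (\<lambda>J. if Rep_mono J = I
     then (case I of (i1, i2, i3) \<Rightarrow> scal (of_nat (fact i1 * fact i2 * fact i3)) (basis j)) else 0)"

abbreviation psi :: "nat \<times> nat \<times> nat \<Rightarrow> gen \<Rightarrow> 'k::field cochain" where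
  "psi \<equiv> phi"

end

(* The linear dual of S(W) is K[[z]] tensor the exterior algebra on theta_1, theta_2. Dually, coalgebra
   automorphisms are changes of the coordinates (theta_1, theta_2, z), and an odd codifferential is an odd
   vector field D with D^2 = 0. If d_1 <> 0, D is normalised by explicit coordinates: either z is moved, and
   z, Dz and a D-invariant odd function (found by solving a linear ODE) are coordinates with D = theta_2 d/dz;
   or some odd coordinate theta_i has image Dtheta_i that can replace z, and subtracting a multiple of theta_i
   makes the other odd coordinate invariant, so that D = z d/dtheta_1.
   The two normal forms are inequivalent because the second one kills all odd primitive elements of S(W),
   while the first one maps w_2 to w_3. *)
theory Submission
  imports
    Defs
    "HOL-Computational_Algebra.Formal_Power_Series"
    "HOL-Library.Product_Plus"
begin

section \<open>Functionals on free vector spaces\<close>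

text \<open>S(W) is a direct sum, so its full dual is a product: every functional on it is a
  superseries, and equality of elements of S(W) can be tested on superseries. Under this pairing the
  signed sums over unshuffles become the product of superseries and the Leibniz rule, so that the
  remaining computations take place in a commutative ring of power series. The price is paid on the
  way back. A map of superseries comes from a map of S(W) only if each output coefficient depends on
  finitely many input coefficients, and transposition reverses composition, so a coordinate change
  yields the inverse of the automorphism that is wanted. Characteristic zero enters through
  factorials in the pairing, through [d,d] = 2 d(coder d), and through the solution of differential
  equations.\<close>

definition ev :: "('b \<Rightarrow> 'k::field) \<Rightarrow> ('b \<Rightarrow>\<^sub>0 'k) \<Rightarrow> 'k" where
  "ev f x = (\<Sum>b\<in>Poly_Mapping.keys x. Poly_Mapping.lookup x b * f b)"

lemma ev_superset:
  assumes "finite A" "Poly_Mapping.keys x \<subseteq> A"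
  shows "ev f x = (\<Sum>b\<in>A. Poly_Mapping.lookup x b * f b)"
  unfolding ev_def using assms
  by (intro sum.mono_neutral_left) (auto simp: in_keys_iff)

lemma ev_single [simp]: "ev f (Poly_Mapping.single b c) = c * f b"
  by (subst ev_superset[of "{b}"]) auto

lemma ev_zero [simp]: "ev f 0 = 0"
  by (simp add: ev_def)

lemma ev_add: "ev f (x + y) = ev f x + ev f y"
proof -
  let ?A = "Poly_Mapping.keys x \<union> Poly_Mapping.keys y"
  have "Poly_Mapping.keys (x + y) \<subseteq> ?A" by (rule Poly_Mapping.keys_add)
  then show ?thesis
    by (simp add: ev_superset[of ?A] lookup_add distrib_right sum.distrib)
qed

lemma ev_scal [simp]: "ev f (scal c x) = c * ev f x"
proof -
  have "Poly_Mapping.keys (scal c x) \<subseteq> Poly_Mapping.keys x" by (auto simp: in_keys_iff)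
  then show ?thesis
    by (simp add: ev_superset[of "Poly_Mapping.keys x"] sum_distrib_left mult.assoc)
qed

lemma ev_sum: "ev f (\<Sum>i\<in>A. g i) = (\<Sum>i\<in>A. ev f (g i))"
  by (induction A rule: infinite_finite_induct) (auto simp: ev_add)

lemma ev_lin_ext: "ev f (lin_ext g x) = ev (\<lambda>b. ev f (g b)) x"
  by (simp add: lin_ext_def ev_sum ev_def[of _ x])

lemma lookup_eq_ev: "Poly_Mapping.lookup x b = ev (\<lambda>c. of_bool (c = b)) x"
  by (subst ev_superset[of "insert b (Poly_Mapping.keys x)"]) (auto simp: sum.remove[of _ b])

lemma ev_eqI: "(\<And>f. ev f x = ev f y) \<Longrightarrow> x = y"
  by (rule poly_mapping_eqI) (simp add: lookup_eq_ev)

section \<open>Linear maps and their values on a basis\<close>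

lemma lin_add: "lin f \<Longrightarrow> f (x + y) = f x + f y"
  by (rule Vector_Spaces.linear.axioms(3)[THEN module_hom.add])
     
lemma lin_scal: "lin f \<Longrightarrow> f (scal c x) = scal c (f x)"
  by (rule Vector_Spaces.linear.axioms(3)[THEN module_hom.scale])

lemma lin_zero: "lin f \<Longrightarrow> f 0 = 0"
  by (rule Vector_Spaces.linear.axioms(3)[THEN module_hom.zero])

lemma lin_sum: "lin f \<Longrightarrow> f (\<Sum>i\<in>A. g i) = (\<Sum>i\<in>A. f (g i))"
  by (rule Vector_Spaces.linear.axioms(3)[THEN module_hom.sum])

lemma linI:
  fixes f :: "('a \<Rightarrow>\<^sub>0 'k::field) \<Rightarrow> ('b \<Rightarrow>\<^sub>0 'k)"
  assumes "\<And>x y. f (x + y) = f x + f y" "\<And>c x. f (scal c x) = scal c (f x)"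
  shows "lin f"
proof -
  interpret v1: vector_space "scal :: 'k \<Rightarrow> ('a \<Rightarrow>\<^sub>0 'k) \<Rightarrow> _" by (rule vector_space_scal)
  interpret v2: vector_space "scal :: 'k \<Rightarrow> ('b \<Rightarrow>\<^sub>0 'k) \<Rightarrow> _" by (rule vector_space_scal)
  show ?thesis by unfold_locales (simp_all add: assms)
qed

lemma lin_eq_lin_ext:
  assumes f: "lin f"
  shows "f x = lin_ext (\<lambda>b. f (basis b)) x"
proof -
  have "x = (\<Sum>b\<in>Poly_Mapping.keys x. scal (Poly_Mapping.lookup x b) (basis b))"
    by (rule ev_eqI) (simp add: ev_sum ev_def[of _ x])
  from arg_cong[where f = f, OF this] show ?thesis
    by (simp add: lin_sum[OF f] lin_scal[OF f] lin_ext_def)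
qed

lemma ev_lin: "lin f \<Longrightarrow> ev u (f x) = ev (\<lambda>b. ev u (f (basis b))) x"
  using lin_eq_lin_ext[of f x] ev_lin_ext by metis

section \<open>Functionals on tensor products\<close>

definition ev2 :: "('a \<Rightarrow> 'k::field) \<Rightarrow> ('b \<Rightarrow> 'k) \<Rightarrow> ('a \<times> 'b \<Rightarrow>\<^sub>0 'k) \<Rightarrow> 'k" where
  "ev2 f g = ev (\<lambda>(a, b). f a * g b)"

lemma ev2_tensor [simp]: "ev2 f g (tensor x y) = ev f x * ev g y"
  unfolding ev2_def tensor_def ev_sum ev_single unfolding ev_def[of _ x] ev_def[of _ y] sum_product
  by (intro sum.cong refl) auto

lemma ev2_scal [simp]: "ev2 f g (scal c x) = c * ev2 f g x"
  by (simp add: ev2_def)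

lemma ev2_sum: "ev2 f g (\<Sum>i\<in>A. h i) = (\<Sum>i\<in>A. ev2 f g (h i))"
  by (simp add: ev2_def ev_sum)

text \<open>Coordinates on a tensor product are products of coordinate functionals, so product
  functionals separate points.\<close>

lemma ev2_eqI:
  fixes x y :: "'a \<times> 'b \<Rightarrow>\<^sub>0 'k::field"
  assumes "\<And>f g. ev2 f g x = ev2 f g y"
  shows "x = y"
proof (rule poly_mapping_eqI)
  fix c :: "'a \<times> 'b"
  obtain a b where c: "c = (a, b)" by fastforce
  from assms[of "\<lambda>u. of_bool (u = a)" "\<lambda>u. of_bool (u = b)"]
  have "ev (\<lambda>u. of_bool (u = c)) x = ev (\<lambda>u. of_bool (u = c)) y"
    by (simp add: ev2_def c case_prod_unfold prod_eq_iff flip: of_bool_conj)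
  then show "Poly_Mapping.lookup x c = Poly_Mapping.lookup y c" by (simp add: lookup_eq_ev)
qed

lemma ev2_tensor_map:
  "ev2 f g (tensor_map u v x) = ev2 (\<lambda>a. ev f (u (basis a))) (\<lambda>b. ev g (v (basis b))) x"
  unfolding tensor_map_def ev2_def ev_lin_ext
  by (simp add: case_prod_unfold flip: ev2_def[unfolded case_prod_unfold])

lemma tensor_map_comp:
  assumes "lin u'" "lin v'"
  shows "tensor_map u' v' (tensor_map u v x) = tensor_map (u' \<circ> u) (v' \<circ> v) x"
  by (rule ev2_eqI) (simp add: ev2_tensor_map flip: ev_lin[OF assms(1)] ev_lin[OF assms(2)])

lemma tensor_map_id: "tensor_map id id x = x"
  by (rule ev2_eqI) (simp add: ev2_tensor_map)


section \<open>Sums over unshuffles\<close>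

text \<open>The Koszul sign of an unshuffle in terms of the set \<open>A\<close> of positions sent
  to the left: a pair counts when a letter of \<open>A\<close> overtakes an earlier letter outside
  \<open>A\<close>.\<close>

definition shuffle_sign :: "gen list \<Rightarrow> nat set \<Rightarrow> 'k::field" where
  "shuffle_sign v A = (\<Prod>(a, b) \<in> {(a, b). b < a \<and> a < length v \<and> a \<in> A \<and> b \<notin> A}.
     ksign (gpar (v ! a)) (gpar (v ! b)))"

lemma filter_mem_upt:
  assumes "A \<subseteq> {..<n}"
  shows "filter (\<lambda>i. i \<in> A) [0..<n] = sorted_list_of_set A"
proof (rule sorted_distinct_set_unique)
  have "finite A" using assms finite_subset by blast
  then show "set (filter (\<lambda>i. i \<in> A) [0..<n]) = set (sorted_list_of_set A)" using assms by auto
qed (auto simp: sorted_wrt_filter)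

lemma nths_eq_map_filter: "nths v A = map ((!) v) (filter (\<lambda>i. i \<in> A) [0..<length v])"
proof -
  have "zip v [0..<length v] = map (\<lambda>i. (v ! i, i)) [0..<length v]"
    by (rule nth_equalityI) auto
  then show ?thesis by (simp add: nths_def filter_map o_def)
qed

lemma map_strict_mono_upt:
  fixes \<sigma> :: "nat \<Rightarrow> nat"
  assumes "strict_mono_on {k..<n} \<sigma>"
  shows "map \<sigma> [k..<n] = sorted_list_of_set (\<sigma> ` {k..<n})"
proof (rule sorted_distinct_set_unique)
  have "sorted_wrt (<) (map \<sigma> [k..<n])"
    using strict_mono_onD[OF assms] by (simp add: sorted_wrt_iff_nth_less)
  then show "sorted (map \<sigma> [k..<n])" "distinct (map \<sigma> [k..<n])"
    by (simp_all add: strict_sorted_iff)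
qed auto

text \<open>An unshuffle is increasing on both blocks, so the image \<open>A\<close> of the first
  block determines it. This trades permutations for subsets.\<close>

lemma unshuffle_words:
  assumes \<sigma>: "\<sigma> \<in> unshuffles k (length v)" and k: "k \<le> length v"
  defines "A \<equiv> \<sigma> ` {..<k}"
  shows "A \<subseteq> {..<length v}" "card A = k"
    and "map (\<lambda>i. v ! \<sigma> i) [0..<k] = nths v A"
    and "map (\<lambda>i. v ! \<sigma> i) [k..<length v] = nths v (- A)"
    and "koszul v \<sigma> = (shuffle_sign v A :: 'k::field)"
    and "map \<sigma> [0..<k] = sorted_list_of_set A"
    and "map \<sigma> [k..<length v] = sorted_list_of_set ({..<length v} - A)"
proof -
  let ?n = "length v"
  have perm: "\<sigma> permutes {..<?n}" and mono1: "strict_mono_on {..<k} \<sigma>"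
    and mono2: "strict_mono_on {k..<?n} \<sigma>"
    using \<sigma> by (auto simp: unshuffles_def)
  have inj: "inj \<sigma>" and img: "\<sigma> ` {..<?n} = {..<?n}"
    using perm by (auto simp: permutes_inj permutes_image)
  show sub: "A \<subseteq> {..<?n}" using img k by (auto simp: A_def)
  show "card A = k" using inj by (simp add: A_def card_image inj_on_subset)
  have "\<sigma> ` {k..<?n} = \<sigma> ` ({..<?n} - {..<k})" by (rule arg_cong) auto
  also have "\<dots> = {..<?n} - A" unfolding A_def image_set_diff[OF inj] img ..
  finally have B: "\<sigma> ` {k..<?n} = {..<?n} - A" .
  show L: "map \<sigma> [0..<k] = sorted_list_of_set A"
    using map_strict_mono_upt[of 0 k \<sigma>] mono1 by (simp add: A_def lessThan_atLeast0)
  show R: "map \<sigma> [k..<?n] = sorted_list_of_set ({..<?n} - A)"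
    using map_strict_mono_upt[OF mono2] B by simp
  have "map (\<lambda>i. v ! \<sigma> i) [0..<k] = map ((!) v) (map \<sigma> [0..<k])" by simp
  also have "\<dots> = nths v A"
    unfolding L nths_eq_map_filter filter_mem_upt[OF sub] ..
  finally show "map (\<lambda>i. v ! \<sigma> i) [0..<k] = nths v A" .
  have "map (\<lambda>i. v ! \<sigma> i) [k..<?n] = map ((!) v) (map \<sigma> [k..<?n])" by simp
  also have "\<dots> = map ((!) v) (filter (\<lambda>i. i \<in> {..<?n} - A) [0..<?n])"
    unfolding R by (subst filter_mem_upt) auto
  also have "\<dots> = nths v (- A)"
    unfolding nths_eq_map_filter by (rule arg_cong, rule filter_cong) auto
  finally show "map (\<lambda>i. v ! \<sigma> i) [k..<?n] = nths v (- A)" .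
  have A_iff: "\<sigma> i \<in> A \<longleftrightarrow> i < k" for i
    using inj by (auto simp: A_def inj_def)
  \<comment> \<open>Within a block \<sigma> is increasing, so an inversion pairs an index of the
    first block with one of the second; \<sigma> carries these pairs onto those counted by
    \<open>shuffle_sign\<close>.\<close>
  have bij: "bij_betw (map_prod \<sigma> \<sigma>) {(i, j). i < j \<and> j < ?n \<and> \<sigma> j < \<sigma> i}
      {(a, b). b < a \<and> a < ?n \<and> a \<in> A \<and> b \<notin> A}"
  proof (rule bij_betw_imageI)
    show "inj_on (map_prod \<sigma> \<sigma>) {(i, j). i < j \<and> j < ?n \<and> \<sigma> j < \<sigma> i}"
      using inj by (auto simp: inj_on_def inj_def)
    have lt: "i < k \<and> \<not> j < k" if "i < j" "j < ?n" "\<sigma> j < \<sigma> i" for i j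
      using that strict_mono_onD[OF mono1, of i j] strict_mono_onD[OF mono2, of i j] by force
    have ex: "\<exists>i j. a = \<sigma> i \<and> b = \<sigma> j \<and> i < j \<and> j < ?n"
      if ab: "b < a" "a < ?n" "a \<in> A" "b \<notin> A" for a b
    proof -
      obtain i j where ij: "a = \<sigma> i" "b = \<sigma> j" "i < ?n" "j < ?n"
      proof -
        have "a \<in> \<sigma> ` {..<?n}" "b \<in> \<sigma> ` {..<?n}" unfolding img using ab by auto
        then show ?thesis using that by blast
      qed
      moreover have "i < k" "\<not> j < k" using A_iff ab ij by auto
      ultimately show ?thesis by (intro exI[of _ i] exI[of _ j]) auto
    qed
    have im: "\<sigma> i < ?n" if "i < ?n" for i using that img by blast
    show "map_prod \<sigma> \<sigma> ` {(i, j). i < j \<and> j < ?n \<and> \<sigma> j < \<sigma> i} =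
        {(a, b). b < a \<and> a < ?n \<and> a \<in> A \<and> b \<notin> A}" (is "_ ` ?L = ?R")
    proof (intro equalityI subsetI)
      fix p assume "p \<in> ?R"
      then obtain a b where p: "p = (a, b)" "b < a" "a < ?n" "a \<in> A" "b \<notin> A" by auto
      with ex[OF p(2-5)] obtain i j where "a = \<sigma> i" "b = \<sigma> j" "i < j" "j < ?n" by blast
      with p show "p \<in> map_prod \<sigma> \<sigma> ` ?L" by (intro image_eqI[of _ _ "(i, j)"]) auto
    next
      fix p assume "p \<in> map_prod \<sigma> \<sigma> ` ?L"
      then obtain i j where p: "p = (\<sigma> i, \<sigma> j)" "i < j" "j < ?n" "\<sigma> j < \<sigma> i" by auto
      with lt[OF p(2-4)] A_iff im[of i] show "p \<in> ?R" by auto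
    qed
  qed
  show "koszul v \<sigma> = (shuffle_sign v A :: 'k)"
    unfolding koszul_def shuffle_sign_def
    by (subst prod.reindex_bij_betw[OF bij, symmetric]) (auto intro!: prod.cong)
qed

lemma unshuffle_exists:
  assumes A: "A \<subseteq> {..<n}" "card A = k"
  shows "\<exists>\<sigma> \<in> unshuffles k n. \<sigma> ` {..<k} = A"
proof -
  \<comment> \<open>The increasing enumeration of \<open>A\<close> is followed by that of its
    complement; beyond \<open>n\<close> the permutation is the identity.\<close>
  define l where "l = sorted_list_of_set A @ sorted_list_of_set ({..<n} - A)"
  define \<sigma> where "\<sigma> i = (if i < n then l ! i else i)" for i
  have fin: "finite A" using A finite_subset by blast
  have set_l: "set l = {..<n}" using fin A by (auto simp: l_def)
  have dist: "distinct l" using fin by (auto simp: l_def)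
  have len: "length l = n" using distinct_card[OF dist] set_l by simp
  have kn: "k \<le> n" using A card_mono[of "{..<n}" A] by simp
  have "bij_betw \<sigma> {..<n} {..<n}"
  proof -
    have "bij_betw ((!) l) {..<n} (set l)" using bij_betw_nth[OF dist] len by simp
    then show ?thesis by (subst bij_betw_cong[where g = "(!) l"]) (auto simp: \<sigma>_def set_l)
  qed
  then have "\<sigma> permutes {..<n}" by (rule bij_imp_permutes) (simp add: \<sigma>_def)
  moreover have "\<sigma> i = sorted_list_of_set A ! i" if "i < k" for i
    using that kn A by (simp add: \<sigma>_def l_def nth_append)
  then have left: "map \<sigma> [0..<k] = sorted_list_of_set A"
    using A by (intro nth_equalityI) auto
  have right: "map \<sigma> [k..<n] = sorted_list_of_set ({..<n} - A)"
    using A len by (intro nth_equalityI) (auto simp: \<sigma>_def l_def nth_append card_Diff_subset fin)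
  have "strict_mono_on {a..<b} \<sigma>" if "map \<sigma> [a..<b] = sorted_list_of_set B" for a b B
  proof (rule strict_mono_onI)
    fix r s assume rs: "r \<in> {a..<b}" "s \<in> {a..<b}" "r < s"
    have "sorted_wrt (<) (map \<sigma> [a..<b])" unfolding that by simp
    from sorted_wrt_nth_less[OF this, of "r - a" "s - a"] rs show "\<sigma> r < \<sigma> s" by auto
  qed
  from this[OF left] this[OF right]
  have "strict_mono_on {..<k} \<sigma>" "strict_mono_on {k..<n} \<sigma>" by (simp_all add: lessThan_atLeast0)
  ultimately have "\<sigma> \<in> unshuffles k n" by (simp add: unshuffles_def)
  moreover have "\<sigma> ` {..<k} = A"
    using arg_cong[OF left, of set] fin by (simp add: lessThan_atLeast0)
  ultimately show ?thesis by blast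
qed

lemma sum_unshuffles:
  fixes G :: "'k::field \<Rightarrow> gen list \<Rightarrow> gen list \<Rightarrow> 'c::comm_monoid_add"
  assumes k: "k \<le> length v"
  shows "(\<Sum>\<sigma>\<in>unshuffles k (length v). G (koszul v \<sigma>) (map (\<lambda>i. v ! \<sigma> i) [0..<k])
            (map (\<lambda>i. v ! \<sigma> i) [k..<length v])) =
         (\<Sum>A | A \<subseteq> {..<length v} \<and> card A = k. G (shuffle_sign v A) (nths v A) (nths v (- A)))"
proof -
  have "bij_betw (\<lambda>\<sigma>. \<sigma> ` {..<k}) (unshuffles k (length v)) {A. A \<subseteq> {..<length v} \<and> card A = k}"
  proof (rule bij_betw_imageI)
    show "inj_on (\<lambda>\<sigma>. \<sigma> ` {..<k}) (unshuffles k (length v))"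
    proof (rule inj_onI)
      fix \<sigma> \<tau> assume st: "\<sigma> \<in> unshuffles k (length v)" "\<tau> \<in> unshuffles k (length v)"
        and eq: "\<sigma> ` {..<k} = \<tau> ` {..<k}"
      have "map \<sigma> [0..<k] = map \<tau> [0..<k]" "map \<sigma> [k..<length v] = map \<tau> [k..<length v]"
        using unshuffle_words(6,7)[OF st(1) k] unshuffle_words(6,7)[OF st(2) k] eq by simp_all
      then have "\<sigma> i = \<tau> i" if "i < length v" for i
        using that by (cases "i < k") auto
      moreover have "\<sigma> i = \<tau> i" if "\<not> i < length v" for i
        using st that by (auto simp: unshuffles_def permutes_def)
      ultimately show "\<sigma> = \<tau>" by blast
    qed
    show "(\<lambda>\<sigma>. \<sigma> ` {..<k}) ` unshuffles k (length v) = {A. A \<subseteq> {..<length v} \<and> card A = k}"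
    proof (intro equalityI subsetI)
      fix A assume "A \<in> {A. A \<subseteq> {..<length v} \<and> card A = k}"
      then show "A \<in> (\<lambda>\<sigma>. \<sigma> ` {..<k}) ` unshuffles k (length v)"
        using unshuffle_exists[of A "length v" k] by blast
    qed (use unshuffle_words(1,2)[OF _ k] in blast)
  qed
  note re = sum.reindex_bij_betw[OF this,
      of "\<lambda>A. G (shuffle_sign v A) (nths v A) (nths v (- A))", symmetric]
  have G: "G (koszul v \<sigma>) (map (\<lambda>i. v ! \<sigma> i) [0..<k]) (map (\<lambda>i. v ! \<sigma> i) [k..<length v]) =
      G (shuffle_sign v (\<sigma> ` {..<k})) (nths v (\<sigma> ` {..<k})) (nths v (- \<sigma> ` {..<k}))"
    if "\<sigma> \<in> unshuffles k (length v)" for \<sigma>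
    unfolding unshuffle_words(3)[OF that k] unshuffle_words(4)[OF that k]
      unshuffle_words(5)[OF that k] ..
  show ?thesis unfolding re by (rule sum.cong[OF refl]) (rule G)
qed

definition splits :: "gen list \<Rightarrow> (gen list \<Rightarrow> gen list \<Rightarrow> 'k::field) \<Rightarrow> 'k" where
  "splits v g = (\<Sum>A\<in>Pow {..<length v}. shuffle_sign v A * g (nths v A) (nths v (- A)))"

lemma sum_all_unshuffles:
  fixes g :: "gen list \<Rightarrow> gen list \<Rightarrow> 'k::field"
  assumes K: "\<And>k. k \<in> K \<Longrightarrow> k \<le> length v" and fin: "finite K"
  shows "(\<Sum>k\<in>K. \<Sum>\<sigma>\<in>unshuffles k (length v). koszul v \<sigma> *
      g (map (\<lambda>i. v ! \<sigma> i) [0..<k]) (map (\<lambda>i. v ! \<sigma> i) [k..<length v])) =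
    splits v (\<lambda>l r. of_bool (length l \<in> K) * g l r)"
proof -
  let ?F = "\<lambda>A. shuffle_sign v A * g (nths v A) (nths v (- A))"
  have card: "length (nths v A) = card A" if "A \<subseteq> {..<length v}" for A
    using that by (simp add: nths_eq_map_filter filter_mem_upt)
  have "(\<Sum>k\<in>K. \<Sum>\<sigma>\<in>unshuffles k (length v). koszul v \<sigma> *
      g (map (\<lambda>i. v ! \<sigma> i) [0..<k]) (map (\<lambda>i. v ! \<sigma> i) [k..<length v])) =
    (\<Sum>k\<in>K. \<Sum>A | A \<subseteq> {..<length v} \<and> card A = k. ?F A)"
    by (intro sum.cong refl sum_unshuffles[where G = "\<lambda>s l r. s * g l r"] K)
  also have "\<dots> = (\<Sum>k\<in>K. \<Sum>A | A \<in> {A \<in> Pow {..<length v}. card A \<in> K} \<and> card A = k. ?F A)"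
    by (intro sum.cong refl) auto
  also have "\<dots> = (\<Sum>A | A \<in> Pow {..<length v} \<and> card A \<in> K. ?F A)"
    by (rule sum.group) (use fin in auto)
  also have "\<dots> = (\<Sum>A\<in>Pow {..<length v}. of_bool (card A \<in> K) * ?F A)"
    by (intro sum.mono_neutral_cong_left) auto
  also have "\<dots> = splits v (\<lambda>l r. of_bool (length l \<in> K) * g l r)"
    unfolding splits_def by (intro sum.cong refl) (simp add: card)
  finally show ?thesis .
qed

section \<open>Recursion for signed splittings of a word\<close>

definition pass_sign :: "gen \<Rightarrow> gen list \<Rightarrow> 'k::field" where
  "pass_sign x l = (\<Prod>y\<leftarrow>l. ksign (gpar y) (gpar x))"

lemma splits_Nil [simp]: "splits [] g = g [] []"
  by (simp add: splits_def shuffle_sign_def)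

text \<open>The first letter goes to the left factor at no cost, or to the right factor, in which
  case every letter of the left factor has to pass it.\<close>

lemma splits_Cons [simp]:
  fixes g :: "gen list \<Rightarrow> gen list \<Rightarrow> 'k::field"
  shows "splits (x # v) g = splits v (\<lambda>l r. g (x # l) r + pass_sign x l * g l (x # r))"
proof -
  let ?n = "length v"
  let ?F = "\<lambda>A. shuffle_sign (x # v) A * g (nths (x # v) A) (nths (x # v) (- A))"
  have less: "{..<Suc ?n} = insert 0 (Suc ` {..<?n})" by (auto simp: lessThan_Suc_eq_insert_0)
  have pow: "Pow {..<length (x # v)} = ((`) Suc) ` Pow {..<?n} \<union> (\<lambda>B. insert 0 (Suc ` B)) ` Pow {..<?n}"
    unfolding length_Cons less Pow_insert image_Pow_surj[OF refl, symmetric] by (auto simp: image_image)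
  have sh1: "shuffle_sign (x # v) (insert 0 (Suc ` B)) = (shuffle_sign v B :: 'k)" for B
  proof -
    have "{(a, b). b < a \<and> a < length (x # v) \<and> a \<in> insert 0 (Suc ` B) \<and> b \<notin> insert 0 (Suc ` B)} =
      map_prod Suc Suc ` {(a, b). b < a \<and> a < ?n \<and> a \<in> B \<and> b \<notin> B}" (is "?L = _ ` ?R")
    proof (intro set_eqI iffI)
      fix p assume "p \<in> ?L"
      then obtain a b where "p = (a, b)" "b < a" "a < length (x # v)" "a \<in> insert 0 (Suc ` B)"
        "b \<notin> insert 0 (Suc ` B)" by auto
      then show "p \<in> map_prod Suc Suc ` ?R"
        by (intro image_eqI[of _ _ "(a - 1, b - 1)"]) (auto, (cases b; auto)+)
    qed auto
    moreover have "inj_on (map_prod Suc Suc) S" for S by (auto simp: inj_on_def)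
    ultimately show ?thesis
      by (simp add: shuffle_sign_def prod.reindex case_prod_unfold)
  qed
  \<comment> \<open>When position 0 lies outside the set, each left letter contributes one
    additional pair, namely with position 0; these pairs make up \<open>pass_sign\<close>.\<close>
  have sh2: "shuffle_sign (x # v) (Suc ` B) = (shuffle_sign v B * pass_sign x (nths v B) :: 'k)"
    if B: "B \<subseteq> {..<?n}" for B
  proof -
    have fB: "finite B" using B finite_subset by blast
    let ?R = "{(a, b). b < a \<and> a < ?n \<and> a \<in> B \<and> b \<notin> B}"
    have "{(a, b). b < a \<and> a < length (x # v) \<and> a \<in> Suc ` B \<and> b \<notin> Suc ` B} =
      map_prod Suc Suc ` ?R \<union> (\<lambda>a. (Suc a, 0)) ` B" (is "?L = _")
    proof (intro set_eqI iffI)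
      fix p assume "p \<in> ?L"
      then obtain a b where p: "p = (Suc a, b)" "b < Suc a" "a < ?n" "a \<in> B" "b \<notin> Suc ` B" by auto
      then show "p \<in> map_prod Suc Suc ` ?R \<union> (\<lambda>a. (Suc a, 0)) ` B"
        by (cases b) (auto intro!: image_eqI[of _ "map_prod Suc Suc" "(a, b - 1)"])
    qed (use B in auto)
    moreover have "map_prod Suc Suc ` ?R \<inter> (\<lambda>a. (Suc a, 0)) ` B = {}" by auto
    moreover have "finite ?R" by (rule finite_subset[of _ "{..<?n} \<times> {..<?n}"]) auto
    moreover have "inj_on (map_prod Suc Suc) S" for S by (auto simp: inj_on_def)
    moreover have "inj_on (\<lambda>a. (Suc a, 0::nat)) S" for S by (auto simp: inj_on_def)
    moreover have "(pass_sign x (nths v B) :: 'k) = (\<Prod>a\<in>B. ksign (gpar (v ! a)) (gpar x))"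
      using fB by (simp add: pass_sign_def nths_eq_map_filter filter_mem_upt[OF B] o_def
          prod.distinct_set_conv_list[symmetric])
    ultimately show ?thesis
      using fB by (simp add: shuffle_sign_def prod.union_disjoint prod.reindex case_prod_unfold)
  qed
  have n1: "nths (x # v) (Suc ` B) = nths v B" "nths (x # v) (insert 0 (Suc ` B)) = x # nths v B" for B
    by (simp_all add: nths_Cons image_iff)
  have n2: "nths (x # v) (- Suc ` B) = x # nths v (- B)"
    "nths (x # v) (- insert 0 (Suc ` B)) = nths v (- B)" for B
  proof -
    have "{j. \<forall>x\<in>B. j \<noteq> x} = - B" by auto
    then show "nths (x # v) (- Suc ` B) = x # nths v (- B)"
      "nths (x # v) (- insert 0 (Suc ` B)) = nths v (- B)"
      by (simp_all add: nths_Cons image_iff flip: Compl_eq)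
  qed
  have "splits (x # v) g = sum ?F (((`) Suc) ` Pow {..<?n}) + sum ?F ((\<lambda>B. insert 0 (Suc ` B)) ` Pow {..<?n})"
    unfolding splits_def pow by (rule sum.union_disjoint) auto
  also have "sum ?F (((`) Suc) ` Pow {..<?n}) = (\<Sum>B\<in>Pow {..<?n}. ?F (Suc ` B))"
    by (rule sum.reindex[unfolded o_def], rule inj_on_inverseI[where g = "\<lambda>C. {j. Suc j \<in> C}"]) auto
  also have "sum ?F ((\<lambda>B. insert 0 (Suc ` B)) ` Pow {..<?n}) = (\<Sum>B\<in>Pow {..<?n}. ?F (insert 0 (Suc ` B)))"
    by (rule sum.reindex[unfolded o_def], rule inj_on_inverseI[where g = "\<lambda>C. {j. Suc j \<in> C}"]) auto
  finally have "splits (x # v) g = (\<Sum>B\<in>Pow {..<?n}. ?F (Suc ` B) + ?F (insert 0 (Suc ` B)))"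
    by (simp only: sum.distrib)
  also have "\<dots> = splits v (\<lambda>l r. g (x # l) r + pass_sign x l * g l (x # r))"
    unfolding splits_def by (intro sum.cong refl) (simp add: n1 n2 sh1 sh2 distrib_left)
  finally show ?thesis .
qed

lemma pass_sign_simps [simp]:
  "pass_sign x [] = 1" "pass_sign x (y # l) = ksign (gpar y) (gpar x) * pass_sign x l"
  by (simp_all add: pass_sign_def)

lemma ksign_simps [simp]: "ksign 0 b = 1" "ksign b 0 = 1" "ksign 1 1 = -1"
  by (simp_all add: ksign_def)

lemma pass_sign_W3 [simp]: "pass_sign W3 l = 1"
  by (induction l) simp_all

lemma pass_sign_replicate_W3 [simp]: "pass_sign x (replicate n W3) = 1"
  by (induction n) simp_all

text \<open>Pascal's rule, in the shape of the recursion for \<open>splits\<close> on the even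
  letter \<open>W3\<close>, which passes without sign.\<close>

lemma sum_binomial_Suc:
  fixes f :: "nat \<Rightarrow> nat \<Rightarrow> 'k::comm_ring_1"
  shows "(\<Sum>j\<le>Suc n. of_nat (Suc n choose j) * f j (Suc n - j)) =
    (\<Sum>j\<le>n. of_nat (n choose j) * (f (Suc j) (n - j) + f j (Suc (n - j))))"
proof -
  have "(\<Sum>j\<le>Suc n. of_nat (Suc n choose j) * f j (Suc n - j)) =
      f 0 (Suc n) + (\<Sum>j\<le>n. of_nat ((n choose j) + (n choose Suc j)) * f (Suc j) (n - j))"
    by (subst sum.atMost_Suc_shift) (simp flip: of_nat_add)
  also have "\<dots> = (\<Sum>j\<le>n. of_nat (n choose j) * f (Suc j) (n - j)) +
      (f 0 (Suc n) + (\<Sum>j\<le>n. of_nat (n choose Suc j) * f (Suc j) (n - j)))"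
    by (simp add: distrib_right sum.distrib)
  also have "f 0 (Suc n) + (\<Sum>j\<le>n. of_nat (n choose Suc j) * f (Suc j) (n - j)) =
      (\<Sum>j\<le>Suc n. of_nat (n choose j) * f j (Suc n - j))"
    by (subst sum.atMost_Suc_shift) (simp del: sum.atMost_Suc)
  also have "\<dots> = (\<Sum>j\<le>n. of_nat (n choose j) * f j (Suc (n - j)))"
    by (simp add: binomial_eq_0 Suc_diff_le)
  finally show ?thesis by (simp add: distrib_left sum.distrib)
qed

lemma splits_replicate_W3:
  "splits (replicate n W3) g =
    (\<Sum>j\<le>n. of_nat (n choose j) * g (replicate j W3) (replicate (n - j) W3))"
proof (induction n arbitrary: g)
  case (Suc n)
  show ?case
    unfolding sum_binomial_Suc[of n "\<lambda>i j. g (replicate i W3) (replicate j W3)"]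
    by (simp add: Suc.IH)
qed simp


section \<open>Superseries as functionals\<close>

text \<open>The tuple \<open>(a0, a1, a2, a3)\<close> stands for \<open>a0 + \<theta>\<^sub>1 a1 + \<theta>\<^sub>2 a2 + \<theta>\<^sub>1\<theta>\<^sub>2 a3\<close> with
  odd \<open>\<theta>\<^sub>1\<close>, \<open>\<theta>\<^sub>2\<close>; the coordinates \<open>(\<theta>\<^sub>1, \<theta>\<^sub>2, z)\<close> are dual to \<open>(w_1, w_2, w_3)\<close>.\<close>

type_synonym 'k sps = "'k fps \<times> 'k fps \<times> 'k fps \<times> 'k fps"

abbreviation mono3 :: "nat \<Rightarrow> nat \<Rightarrow> nat \<Rightarrow> mono" where
  "mono3 i1 i2 i3 \<equiv> Abs_mono (i1, i2, i3)"

text \<open>The power of w_3 with exponent n pairs with a series as its n-th Taylor derivative at 0.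
  This factorial turns the binomial sums coming from unshuffles into Cauchy products.\<close>

definition ser :: "'k::field_char_0 sps \<Rightarrow> mono \<Rightarrow> 'k" where
  "ser a I = (case Rep_mono I of (i1, i2, i3) \<Rightarrow> case a of (a0, a1, a2, a3) \<Rightarrow>
     fact i3 * fps_nth (if i1 = 0 then if i2 = 0 then a0 else a2 else if i2 = 0 then a1 else a3) i3)"

text \<open>There is no multi-index (0,0,0), so the constant term of \<open>a0\<close> is invisible
  to S(W); fixing it to 0 makes \<open>ser\<close> injective.\<close>

definition reduced :: "'k::field_char_0 sps set" where
  "reduced = {(a0, a1, a2, a3). fps_nth a0 0 = 0}"

lemma reduced_iff [simp]: "(a0, a1, a2, a3) \<in> reduced \<longleftrightarrow> fps_nth a0 0 = 0"
  by (simp add: reduced_def)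

lemma Rep_mono3: "i1 \<le> 1 \<Longrightarrow> i2 \<le> 1 \<Longrightarrow> 1 \<le> i1 + i2 + i3 \<Longrightarrow> Rep_mono (mono3 i1 i2 i3) = (i1, i2, i3)"
  by (rule Abs_mono_inverse) simp

lemma mono_cases:
  obtains n where "J = mono3 0 0 (Suc n)" | n where "J = mono3 (Suc 0) 0 n"
  | n where "J = mono3 0 (Suc 0) n" | n where "J = mono3 (Suc 0) (Suc 0) n"
proof -
  obtain i1 i2 i3 where R: "Rep_mono J = (i1, i2, i3)" by (metis prod_cases3)
  then have J: "J = mono3 i1 i2 i3" by (metis Rep_mono_inverse)
  have "i1 \<le> 1 \<and> i2 \<le> 1 \<and> 1 \<le> i1 + i2 + i3" using Rep_mono[of J] R by simp
  then consider "i1 = 0" "i2 = 0" "i3 > 0" | "i1 = Suc 0" "i2 = 0" | "i1 = 0" "i2 = Suc 0"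
    | "i1 = Suc 0" "i2 = Suc 0" by linarith
  then show ?thesis using J that by cases (use gr0_conv_Suc in auto)
qed

lemma Rep_mono_simps [simp]:
  "Rep_mono (mono3 0 0 (Suc n)) = (0, 0, Suc n)"
  "Rep_mono (mono3 (Suc 0) 0 n) = (Suc 0, 0, n)"
  "Rep_mono (mono3 0 (Suc 0) n) = (0, Suc 0, n)"
  "Rep_mono (mono3 (Suc 0) (Suc 0) n) = (Suc 0, Suc 0, n)"
  by (simp_all add: Rep_mono3)

lemma ser_simps [simp]:
  "ser (a0, a1, a2, a3) (mono3 0 0 (Suc n)) = fact (Suc n) * fps_nth a0 (Suc n)"
  "ser (a0, a1, a2, a3) (mono3 (Suc 0) 0 n) = fact n * fps_nth a1 n"
  "ser (a0, a1, a2, a3) (mono3 0 (Suc 0) n) = fact n * fps_nth a2 n"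
  "ser (a0, a1, a2, a3) (mono3 (Suc 0) (Suc 0) n) = fact n * fps_nth a3 n"
  by (simp_all add: ser_def del: fact_Suc)

lemma mpar_simps [simp]:
  "mpar (mono3 0 0 (Suc n)) = 0" "mpar (mono3 (Suc 0) 0 n) = 1"
  "mpar (mono3 0 (Suc 0) n) = 1" "mpar (mono3 (Suc 0) (Suc 0) n) = 0"
  by (simp_all add: mpar_def)

lemma mword_simps [simp]:
  "mword (mono3 0 0 (Suc n)) = replicate (Suc n) W3"
  "mword (mono3 (Suc 0) 0 n) = W1 # replicate n W3"
  "mword (mono3 0 (Suc 0) n) = W2 # replicate n W3"
  "mword (mono3 (Suc 0) (Suc 0) n) = W1 # W2 # replicate n W3"
  by (simp_all add: mword_def del: replicate_Suc) (simp_all add: replicate_Suc)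

lemma ser_eqI:
  assumes "a \<in> reduced" "b \<in> reduced" "\<And>J. ser a J = ser b J"
  shows "a = b"
proof -
  obtain a0 a1 a2 a3 b0 b1 b2 b3 where ab: "a = (a0, a1, a2, a3)" "b = (b0, b1, b2, b3)"
    by (metis prod_cases4)
  have "fps_nth a0 n = fps_nth b0 n" for n
    using assms(1,2) assms(3)[of "mono3 0 0 n"] unfolding ab
    by (cases n) (simp_all del: fact_Suc)
  moreover have "fps_nth a1 n = fps_nth b1 n" "fps_nth a2 n = fps_nth b2 n"
    "fps_nth a3 n = fps_nth b3 n" for n
    using assms(3)[of "mono3 (Suc 0) 0 n"] assms(3)[of "mono3 0 (Suc 0) n"]
      assms(3)[of "mono3 (Suc 0) (Suc 0) n"] unfolding ab by simp_all
  ultimately show ?thesis unfolding ab by (simp add: fps_eq_iff)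
qed

lemma ser_surj: "\<exists>a\<in>reduced. f = ser a"
proof -
  let ?a = "(Abs_fps (\<lambda>n. if n = 0 then 0 else f (mono3 0 0 n) / fact n),
    Abs_fps (\<lambda>n. f (mono3 (Suc 0) 0 n) / fact n), Abs_fps (\<lambda>n. f (mono3 0 (Suc 0) n) / fact n),
    Abs_fps (\<lambda>n. f (mono3 (Suc 0) (Suc 0) n) / fact n))"
  have "f J = ser ?a J" for J
    by (cases J rule: mono_cases) (simp_all del: fact_Suc)
  moreover have "?a \<in> reduced" by simp
  ultimately show ?thesis by blast
qed

lemma ev_ser_eqI:
  fixes x y :: "'k::field_char_0 symW"
  assumes "\<And>a. a \<in> reduced \<Longrightarrow> ev (ser a) x = ev (ser a) y"
  shows "x = y"
  by (rule ev_eqI) (use assms ser_surj in metis)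

lemma ev2_ser_eqI:
  fixes x y :: "mono \<times> mono \<Rightarrow>\<^sub>0 'k::field_char_0"
  assumes "\<And>a b. a \<in> reduced \<Longrightarrow> b \<in> reduced \<Longrightarrow> ev2 (ser a) (ser b) x = ev2 (ser a) (ser b) y"
  shows "x = y"
  by (rule ev2_eqI) (use assms ser_surj in metis)


subsection \<open>Values on words\<close>

definition word_sign :: "gen list \<Rightarrow> 'k::field" where
  "word_sign xs = (\<Prod>(i, j) \<in> {(i, j). i < j \<and> j < length xs \<and> gidx (xs ! j) < gidx (xs ! i)}.
     ksign (gpar (xs ! i)) (gpar (xs ! j)))"

lemma word_sign_Nil [simp]: "word_sign [] = 1"
  by (simp add: word_sign_def)

lemma word_sign_Cons [simp]:
  "word_sign (x # xs) =
    (\<Prod>y\<leftarrow>xs. if gidx y < gidx x then ksign (gpar x) (gpar y) else 1) * (word_sign xs :: 'k::field)"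
proof -
  let ?n = "length xs"
  let ?R = "{(i, j). i < j \<and> j < ?n \<and> gidx (xs ! j) < gidx (xs ! i)}"
  let ?B = "{j. j < ?n \<and> gidx (xs ! j) < gidx x}"
  have "{(i, j). i < j \<and> j < length (x # xs) \<and> gidx ((x # xs) ! j) < gidx ((x # xs) ! i)} =
      map_prod Suc Suc ` ?R \<union> (\<lambda>j. (0, Suc j)) ` ?B" (is "?L = _")
  proof (intro set_eqI iffI)
    fix p assume "p \<in> ?L"
    then obtain i j where p: "p = (i, Suc j)" "i < Suc j" "j < ?n"
      "gidx (xs ! j) < gidx ((x # xs) ! i)"
      by (cases p; cases "snd p") auto
    then show "p \<in> map_prod Suc Suc ` ?R \<union> (\<lambda>j. (0, Suc j)) ` ?B"
      by (cases i) (auto intro!: image_eqI[of _ "map_prod Suc Suc" "(i - 1, j)"])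
  qed auto
  moreover have "map_prod Suc Suc ` ?R \<inter> (\<lambda>j. (0, Suc j)) ` ?B = {}" by auto
  moreover have "finite ?R" by (rule finite_subset[of _ "{..<?n} \<times> {..<?n}"]) auto
  moreover have "inj_on (map_prod Suc Suc) S" for S by (auto simp: inj_on_def)
  moreover have "inj_on (\<lambda>j. (0::nat, Suc j)) S" for S by (auto simp: inj_on_def)
  moreover have "(\<Prod>y\<leftarrow>xs. if gidx y < gidx x then ksign (gpar x) (gpar y) else 1 :: 'k) =
      (\<Prod>j\<in>?B. ksign (gpar x) (gpar (xs ! j)))"
  proof -
    have "(\<Prod>y\<leftarrow>xs. if gidx y < gidx x then ksign (gpar x) (gpar y) else 1 :: 'k) =
      (\<Prod>j<?n. if gidx (xs ! j) < gidx x then ksign (gpar x) (gpar (xs ! j)) else 1)"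
      by (simp add: prod.list_conv_set_nth atLeast0LessThan)
    also have "\<dots> = (\<Prod>j\<in>?B. ksign (gpar x) (gpar (xs ! j)))"
      by (rule prod.mono_neutral_cong_right) auto
    finally show ?thesis .
  qed
  ultimately show ?thesis
    by (simp add: word_sign_def prod.union_disjoint prod.reindex case_prod_unfold mult.commute)
qed

lemma count_list_replicate [simp]: "count_list (replicate n x) y = (if x = y then n else 0)"
  by (induction n) auto

lemma word_sign_replicate [simp]: "word_sign (replicate n x) = 1"
  by (induction n) auto

definition val :: "'k::field_char_0 sps \<Rightarrow> gen list \<Rightarrow> 'k" where
  "val a xs = ev (ser a) (wprod xs)"

lemma val_eq:
  "val a xs = (if xs \<noteq> [] \<and> count_list xs W1 \<le> 1 \<and> count_list xs W2 \<le> 1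
    then word_sign xs * ser a (mono3 (count_list xs W1) (count_list xs W2) (count_list xs W3)) else 0)"
  by (simp add: val_def wprod_def word_sign_def)

text \<open>Such words arise when a sorted word is split and at most one generator is put in front
  of a part. A leading \<open>W3\<close> raises the index by one, which amounts to a derivative
  because of the factorials.\<close>

lemma val_simps:
  assumes "fps_nth a0 0 = 0"
  shows "val (a0, a1, a2, a3) (replicate n W3) = fact n * fps_nth a0 n"
    and "val (a0, a1, a2, a3) (W1 # replicate n W3) = fact n * fps_nth a1 n"
    and "val (a0, a1, a2, a3) (W2 # replicate n W3) = fact n * fps_nth a2 n"
    and "val (a0, a1, a2, a3) (W1 # W2 # replicate n W3) = fact n * fps_nth a3 n"
    and "val (a0, a1, a2, a3) (W2 # W1 # replicate n W3) = - (fact n * fps_nth a3 n)"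
    and "val (a0, a1, a2, a3) (W3 # replicate n W3) = fact n * fps_nth (fps_deriv a0) n"
    and "val (a0, a1, a2, a3) (W3 # W1 # replicate n W3) = fact n * fps_nth (fps_deriv a1) n"
    and "val (a0, a1, a2, a3) (W3 # W2 # replicate n W3) = fact n * fps_nth (fps_deriv a2) n"
    and "val (a0, a1, a2, a3) (W3 # W1 # W2 # replicate n W3) = fact n * fps_nth (fps_deriv a3) n"
  using assms by (simp_all add: val_eq) (cases n; simp)

lemma val_repeated [simp]:
  "val a (W1 # W1 # xs) = 0" "val a (W2 # W2 # xs) = 0" "val a (W2 # W1 # W2 # xs) = 0"
  by (simp_all add: val_eq)

section \<open>Comultiplication and coderivations evaluated on words\<close>

lemma splits_cong:
  assumes "\<And>l r. length l + length r = length v \<Longrightarrow> g l r = h l r"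
  shows "splits v g = splits v h"
  using assms
proof (induction v arbitrary: g h)
  case (Cons x v)
  have "g (x # l) r + pass_sign x l * g l (x # r) = h (x # l) r + pass_sign x l * h l (x # r)"
    if "length l + length r = length v" for l r
    using that by (simp add: Cons.prems)
  from Cons.IH[OF this] show ?case by simp
qed simp

lemma wprod_Nil [simp]: "wprod [] = 0"
  by (simp add: wprod_def)

lemma ev2_comult:
  "ev2 f g (comult (basis J)) = splits (mword J) (\<lambda>l r. ev f (wprod l) * ev g (wprod r))"
proof -
  let ?v = "mword J"
  have "ev2 f g (comult (basis J)) =
    (\<Sum>k\<in>{1..<length ?v}. \<Sum>\<sigma>\<in>unshuffles k (length ?v). koszul ?v \<sigma> *
      (ev f (wprod (map (\<lambda>i. ?v ! \<sigma> i) [0..<k])) * ev g (wprod (map (\<lambda>i. ?v ! \<sigma> i) [k..<length ?v]))))"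
    by (simp add: comult_def Let_def ev2_sum)
  also have "\<dots> = splits ?v (\<lambda>l r. of_bool (length l \<in> {1..<length ?v}) * (ev f (wprod l) * ev g (wprod r)))"
    by (rule sum_all_unshuffles) auto
  \<comment> \<open>The empty blocks, excluded from the comultiplication, contribute nothing since
    \<open>wprod []\<close> is 0.\<close>
  also have "\<dots> = splits ?v (\<lambda>l r. ev f (wprod l) * ev g (wprod r))"
  proof (rule splits_cong)
    fix l r :: "gen list" assume "length l + length r = length ?v"
    then show "of_bool (length l \<in> {1..<length ?v}) * (ev f (wprod l) * ev g (wprod r)) =
      ev f (wprod l) * ev g (wprod r)"
      by (cases l; cases r) auto
  qed
  finally show ?thesis .
qed

lemma sum_count_list: "count_list xs W1 + count_list xs W2 + count_list xs W3 = length xs"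
proof (induction xs)
  case (Cons x xs) then show ?case by (cases x) simp_all
qed simp

text \<open>The product of a word of length n lies in S^n(W), where \<phi> coincides with its n-th
  component; so the components disappear from \<open>coder\<close>.\<close>

lemma component_wprod:
  fixes \<phi> :: "'k::field cochain"
  assumes "lin \<phi>"
  shows "component (length l) \<phi> (wprod l) = \<phi> (wprod l)"
proof (cases "wprod l = (0 :: 'k symW)")
  case True
  then show ?thesis by (simp add: lin_zero[OF assms] component_def lin_zero[OF lin_lin_ext])
next
  case False
  then have l: "l \<noteq> []" "count_list l W1 \<le> 1" "count_list l W2 \<le> 1"
    by (auto simp: wprod_def split: if_splits)
  let ?I = "mono3 (count_list l W1) (count_list l W2) (count_list l W3)"
  have "1 \<le> count_list l W1 + count_list l W2 + count_list l W3"
    using l(1) by (simp add: sum_count_list Suc_le_eq)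
  then have deg: "mdeg ?I = length l"
    using l sum_count_list[of l] by (simp add: mdeg_def Rep_mono3)
  have "\<exists>c::'k. wprod l = scal c (basis ?I)"
    using l by (intro exI[of _ "word_sign l"]) (simp add: wprod_def word_sign_def scal_def)
  then obtain c :: 'k where "wprod l = scal c (basis ?I)" ..
  then show ?thesis
    using deg by (simp add: component_def lin_scal[OF lin_lin_ext] lin_scal[OF assms])
qed

lemma UNIV_gen: "UNIV = {W1, W2, W3}"
  using gen.exhaust by auto

lemma ev_wmult:
  "ev f (wmult u xs) = Poly_Mapping.lookup u W1 * ev f (wprod (W1 # xs)) +
    Poly_Mapping.lookup u W2 * ev f (wprod (W2 # xs)) + Poly_Mapping.lookup u W3 * ev f (wprod (W3 # xs))"
proof -
  have "Poly_Mapping.keys u \<subseteq> {W1, W2, W3}" using UNIV_gen by blast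
  from ev_superset[OF _ this] show ?thesis
    by (simp add: wmult_def ev_lin_ext)
qed

lemma ev_coder:
  assumes d: "lin d"
  shows "ev f (coder d (basis J)) = splits (mword J) (\<lambda>l r. ev f (wmult (d (wprod l)) r))"
proof -
  let ?v = "mword J"
  have "ev f (coder d (basis J)) =
    (\<Sum>k\<in>{1..length ?v}. \<Sum>\<sigma>\<in>unshuffles k (length ?v). koszul ?v \<sigma> *
      ev f (wmult (d (wprod (map (\<lambda>i. ?v ! \<sigma> i) [0..<k]))) (map (\<lambda>i. ?v ! \<sigma> i) [k..<length ?v])))"
    using component_wprod[OF d, of "map h [0..<k]" for h k]
    by (simp add: coder_def Let_def ev_sum)
  also have "\<dots> = splits ?v (\<lambda>l r. of_bool (length l \<in> {1..length ?v}) * ev f (wmult (d (wprod l)) r))"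
    by (rule sum_all_unshuffles) auto
  also have "\<dots> = splits ?v (\<lambda>l r. ev f (wmult (d (wprod l)) r))"
  proof (rule splits_cong)
    fix l r :: "gen list" assume "length l + length r = length ?v"
    then show "of_bool (length l \<in> {1..length ?v}) * ev f (wmult (d (wprod l)) r) =
      ev f (wmult (d (wprod l)) r)"
      by (cases l) (auto simp: lin_zero[OF d] ev_wmult)
  qed
  finally show ?thesis .
qed

lemma binomial_convolution:
  fixes f g :: "'k::field_char_0 fps"
  shows "(\<Sum>j\<le>n. of_nat (n choose j) * (fact j * fps_nth f j * (fact (n - j) * fps_nth g (n - j)))) =
    fact n * fps_nth (f * g) n"
  unfolding fps_mult_nth sum_distrib_left atLeast0AtMost
proof (rule sum.cong[OF refl])
  fix j assume "j \<in> {..n}"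
  then have "(fact n :: 'k) = of_nat (n choose j) * fact j * fact (n - j)"
    by (simp add: binomial_fact)
  then show "of_nat (n choose j) * (fact j * fps_nth f j * (fact (n - j) * fps_nth g (n - j))) =
      fact n * (fps_nth f j * fps_nth g (n - j))"
    by (simp only: ac_simps)
qed

text \<open>The product of superseries; the last sign is that of theta_2 theta_1 = - theta_1
  theta_2.\<close>

fun smul :: "'k::field_char_0 sps \<Rightarrow> 'k sps \<Rightarrow> 'k sps" where
  "smul (a0, a1, a2, a3) (b0, b1, b2, b3) =
    (a0 * b0, a1 * b0 + a0 * b1, a2 * b0 + a0 * b2, a3 * b0 + a0 * b3 + a1 * b2 - a2 * b1)"

text \<open>The transpose of the coderivation is the odd vector field
  \<open>\<theta>\<^sub>1 \<mapsto> p\<^sub>1 + \<theta>\<^sub>1\<theta>\<^sub>2 q\<^sub>1\<close>, \<open>\<theta>\<^sub>2 \<mapsto> p\<^sub>2 + \<theta>\<^sub>1\<theta>\<^sub>2 q\<^sub>2\<close>, \<open>z \<mapsto> \<theta>\<^sub>1 r\<^sub>1 + \<theta>\<^sub>2 r\<^sub>2\<close>.\<close>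

fun vf :: "'k::field_char_0 fps \<times> 'k fps \<times> 'k fps \<times> 'k fps \<times> 'k fps \<times> 'k fps \<Rightarrow> 'k sps \<Rightarrow> 'k sps" where
  "vf (p1, p2, q1, q2, r1, r2) (a0, a1, a2, a3) =
    (p1 * a1 + p2 * a2, r1 * fps_deriv a0 - p2 * a3, r2 * fps_deriv a0 + p1 * a3,
     q1 * a1 + q2 * a2 + r1 * fps_deriv a2 - r2 * fps_deriv a1)"

text \<open>This identifies the algebra dual to the coalgebra S(W): sums over splittings of the even
  letters are Cauchy products, and Koszul signs are those of the odd coordinates.\<close>

lemma ev2_comult_ser:
  assumes "a \<in> reduced" "b \<in> reduced"
  shows "ev2 (ser a) (ser b) (comult x) = ev (ser (smul a b)) x"
proof -
  obtain a0 a1 a2 a3 b0 b1 b2 b3 where ab: "a = (a0, a1, a2, a3)" "b = (b0, b1, b2, b3)"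
    by (metis prod_cases4)
  have 0: "fps_nth a0 0 = 0" "fps_nth b0 0 = 0" using assms by (simp_all add: ab)
  have "splits (mword J) (\<lambda>l r. val a l * val b r) = ser (smul a b) J" for J
    unfolding ab
    by (cases J rule: mono_cases)
      (simp_all add: splits_replicate_W3 val_simps[OF 0(1)] val_simps[OF 0(2)]
        binomial_convolution sum.distrib sum_negf sum_subtractf distrib_left right_diff_distrib
        del: replicate_Suc fact_Suc sum.atMost_Suc)
  then have "ev2 (ser a) (ser b) (comult (basis J)) = ser (smul a b) J" for J
    unfolding ev2_comult val_def[symmetric] .
  moreover have "ev2 (ser a) (ser b) (comult x) = ev (\<lambda>J. ev2 (ser a) (ser b) (comult (basis J))) x"
    unfolding ev2_def by (rule ev_lin) (simp add: comult_def lin_lin_ext)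
  ultimately show ?thesis by simp
qed


subsection \<open>Transposes of coderivations\<close>

text \<open>The coordinates of \<open>d\<close> are the images of theta_1, theta_2 and z under the
  vector field. The zero entries express oddness, and \<open>p1\<close>, \<open>p2\<close> lack a
  constant term because S(W) starts in degree 1.\<close>

definition represents :: "'k::field_char_0 fps \<times> 'k fps \<times> 'k fps \<times> 'k fps \<times> 'k fps \<times> 'k fps \<Rightarrow>
    'k cochain \<Rightarrow> bool" where
  "represents P d \<longleftrightarrow> lin d \<and> (case P of (p1, p2, q1, q2, r1, r2) \<Rightarrow>
     fps_nth p1 0 = 0 \<and> fps_nth p2 0 = 0 \<and>
     (\<forall>x. Poly_Mapping.lookup (d x) W1 = ev (ser (p1, 0, 0, q1)) x) \<and>
     (\<forall>x. Poly_Mapping.lookup (d x) W2 = ev (ser (p2, 0, 0, q2)) x) \<and>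
     (\<forall>x. Poly_Mapping.lookup (d x) W3 = ev (ser (0, r1, r2, 0)) x))"

definition of_parity :: "bit \<Rightarrow> 'k::field_char_0 sps \<Rightarrow> bool" where
  "of_parity e a \<longleftrightarrow> (\<forall>J. mpar J \<noteq> e \<longrightarrow> ser a J = 0)"

lemma of_parity_0_iff [simp]: "of_parity 0 (a0, a1, a2, a3) \<longleftrightarrow> a1 = 0 \<and> a2 = 0"
proof
  assume "of_parity 0 (a0, a1, a2, a3)"
  from this[unfolded of_parity_def, rule_format, of "mono3 (Suc 0) 0 n" for n]
    this[unfolded of_parity_def, rule_format, of "mono3 0 (Suc 0) n" for n]
  show "a1 = 0 \<and> a2 = 0" by (simp add: fps_eq_iff)
next
  assume a: "a1 = 0 \<and> a2 = 0"
  have "mpar J \<noteq> 0 \<longrightarrow> ser (a0, a1, a2, a3) J = 0" for J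
    using a by (cases J rule: mono_cases) simp_all
  then show "of_parity 0 (a0, a1, a2, a3)" by (simp add: of_parity_def)
qed

lemma of_parity_1_iff:
  assumes "fps_nth a0 0 = 0"
  shows "of_parity 1 (a0, a1, a2, a3) \<longleftrightarrow> a0 = 0 \<and> a3 = 0"
proof
  assume a: "of_parity 1 (a0, a1, a2, a3)"
  have "fps_nth a0 n = 0" for n
    using assms a[unfolded of_parity_def, rule_format, of "mono3 0 0 n"]
    by (cases n) (simp_all del: fact_Suc)
  moreover have "fps_nth a3 n = 0" for n
    using a[unfolded of_parity_def, rule_format, of "mono3 (Suc 0) (Suc 0) n"] by simp
  ultimately show "a0 = 0 \<and> a3 = 0" by (simp add: fps_eq_iff)
next
  assume a: "a0 = 0 \<and> a3 = 0"
  have "mpar J \<noteq> 1 \<longrightarrow> ser (a0, a1, a2, a3) J = 0" for J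
    using a by (cases J rule: mono_cases) simp_all
  then show "of_parity 1 (a0, a1, a2, a3)" by (simp add: of_parity_def)
qed

lemma bit_add_swap: "a = b + c \<longleftrightarrow> b = a + c" for a b c :: bit
  by (cases "a = 0"; cases "b = 0"; cases "c = 0") auto

lemma ev_nonzero_key: "ev f x \<noteq> 0 \<Longrightarrow> \<exists>b\<in>Poly_Mapping.keys x. f b \<noteq> 0"
  by (metis (no_types, lifting) ev_def mult_zero_right sum.neutral)

lemma lin_coordinate:
  fixes d :: "'k::field_char_0 symW \<Rightarrow> ('b \<Rightarrow>\<^sub>0 'k)"
  assumes d: "lin d" and par: "has_parity mpar q e d"
  shows "\<exists>a\<in>reduced. of_parity (q j + e) a \<and> (\<forall>x. Poly_Mapping.lookup (d x) j = ev (ser a) x)"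
proof -
  obtain a where a: "a \<in> reduced" "(\<lambda>J. Poly_Mapping.lookup (d (basis J)) j) = ser a"
    using ser_surj by metis
  have "Poly_Mapping.lookup (d x) j = ev (ser a) x" for x
    unfolding a(2)[symmetric] lookup_eq_ev[of "d _" j] by (rule ev_lin[OF d])
  moreover have "ser a J = 0" if "mpar J \<noteq> q j + e" for J
  proof -
    have "basis J \<in> homog mpar (mpar J)" by (simp add: homog_def)
    then have "d (basis J) \<in> homog q (mpar J + e)" using par unfolding has_parity_def by blast
    moreover have "q j \<noteq> mpar J + e" using that bit_add_swap by blast
    ultimately have "Poly_Mapping.lookup (d (basis J)) j = 0"
      by (auto simp: homog_def in_keys_iff)
    then show ?thesis unfolding a(2)[symmetric] .
  qed
  ultimately show ?thesis using a(1) unfolding of_parity_def by blast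
qed

lemma represents_exists:
  fixes d :: "'k::field_char_0 cochain"
  assumes d: "lin d" and par: "has_parity mpar gpar 1 d"
  shows "\<exists>P. represents P d"
proof -
  have odd: "\<exists>p q. fps_nth p 0 = 0 \<and> (\<forall>x. Poly_Mapping.lookup (d x) j = ev (ser (p, 0, 0, q)) x)"
    if j: "gpar j = 1" for j
  proof -
    obtain a where a: "a \<in> reduced" "of_parity (gpar j + 1) a"
      "\<forall>x. Poly_Mapping.lookup (d x) j = ev (ser a) x"
      using lin_coordinate[OF d par] by blast
    obtain a0 a1 a2 a3 where "a = (a0, a1, a2, a3)" by (metis prod_cases4)
    with a j show ?thesis by (intro exI[of _ a0] exI[of _ a3]) simp
  qed
  obtain p1 q1 where "fps_nth p1 0 = 0"
    "\<forall>x. Poly_Mapping.lookup (d x) W1 = ev (ser (p1, 0, 0, q1)) x" using odd[of W1] by fastforce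
  moreover obtain p2 q2 where "fps_nth p2 0 = 0"
    "\<forall>x. Poly_Mapping.lookup (d x) W2 = ev (ser (p2, 0, 0, q2)) x" using odd[of W2] by fastforce
  moreover obtain r1 r2 where
    "\<forall>x. Poly_Mapping.lookup (d x) W3 = ev (ser (0, r1, r2, 0)) x"
  proof -
    obtain a where a: "a \<in> reduced" "of_parity (gpar W3 + 1) a"
      "\<forall>x. Poly_Mapping.lookup (d x) W3 = ev (ser a) x"
      using lin_coordinate[OF d par] by blast
    obtain a0 a1 a2 a3 where "a = (a0, a1, a2, a3)" by (metis prod_cases4)
    with a that[of a1 a2] show ?thesis by (simp add: of_parity_1_iff)
  qed
  ultimately have "represents (p1, p2, q1, q2, r1, r2) d" using d by (simp add: represents_def)
  then show ?thesis ..
qed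

lemma represents_parity:
  assumes "represents P d"
  shows "has_parity mpar gpar 1 d"
proof -
  obtain p1 p2 q1 q2 r1 r2 where P: "P = (p1, p2, q1, q2, r1, r2)" by (metis prod_cases6)
  have "gpar j = c + 1" if x: "x \<in> homog mpar c" and j: "j \<in> Poly_Mapping.keys (d x)" for x c j
  proof -
    have "\<exists>a. of_parity (gpar j + 1) a \<and> Poly_Mapping.lookup (d x) j = ev (ser a) x"
    proof (cases j)
      case W1
      then show ?thesis using assms by (intro exI[of _ "(p1, 0, 0, q1)"]) (simp add: P represents_def)
    next
      case W2
      then show ?thesis using assms by (intro exI[of _ "(p2, 0, 0, q2)"]) (simp add: P represents_def)
    next
      case W3
      then show ?thesis using assms
        by (intro exI[of _ "(0, r1, r2, 0)"]) (simp add: P represents_def of_parity_1_iff)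
    qed
    then obtain a where a: "of_parity (gpar j + 1) a" "Poly_Mapping.lookup (d x) j = ev (ser a) x"
      by blast
    then obtain J where "J \<in> Poly_Mapping.keys x" "ser a J \<noteq> 0"
      using ev_nonzero_key[of "ser a" x] j by (auto simp: in_keys_iff)
    then have "mpar J = gpar j + 1" "mpar J = c"
      using a(1) x unfolding of_parity_def homog_def by blast+
    then show ?thesis using bit_add_swap by metis
  qed
  then show ?thesis by (auto simp: has_parity_def homog_def)
qed

lemma vf_reduced: "represents P d \<Longrightarrow> vf P a \<in> reduced"
  by (cases P, cases a) (auto simp: represents_def)

text \<open>Splitting a word and putting the value of \<open>d\<close> in front of the rest
  transposes to a sum of partial derivatives, each multiplied by the image of its
  coordinate.\<close>

lemma ev_coder_ser:
  assumes P: "represents P d" and a: "a \<in> reduced"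
  shows "ev (ser a) (coder d x) = ev (ser (vf P a)) x"
proof -
  obtain p1 p2 q1 q2 r1 r2 where P_eq: "P = (p1, p2, q1, q2, r1, r2)" by (metis prod_cases6)
  obtain a0 a1 a2 a3 where a_eq: "a = (a0, a1, a2, a3)" by (metis prod_cases4)
  have d: "lin d" and 0: "fps_nth p1 0 = 0" "fps_nth p2 0 = 0" "fps_nth a0 0 = 0"
    and look: "Poly_Mapping.lookup (d (wprod l)) W1 = val (p1, 0, 0, q1) l"
      "Poly_Mapping.lookup (d (wprod l)) W2 = val (p2, 0, 0, q2) l"
      "Poly_Mapping.lookup (d (wprod l)) W3 = val (0, r1, r2, 0) l" for l
    using P a by (simp_all add: represents_def P_eq a_eq val_def)
  have "ev (ser a) (coder d (basis J)) = splits (mword J) (\<lambda>l r.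
      val (p1, 0, 0, q1) l * val a (W1 # r) + val (p2, 0, 0, q2) l * val a (W2 # r) +
      val (0, r1, r2, 0) l * val a (W3 # r))" for J
    unfolding ev_coder[OF d] ev_wmult look val_def[of a] ..
  also have "\<dots> J = ser (vf P a) J" for J
    unfolding P_eq a_eq
    by (cases J rule: mono_cases)
      (simp_all add: splits_replicate_W3 val_simps 0 binomial_convolution sum.distrib sum_negf
        sum_subtractf distrib_left right_diff_distrib
        del: replicate_Suc fact_Suc sum.atMost_Suc fps_deriv_nth)
  finally have "ev (ser a) (coder d (basis J)) = ser (vf P a) J" for J .
  moreover have "ev (ser a) (coder d x) = ev (\<lambda>J. ev (ser a) (coder d (basis J))) x"
    by (rule ev_lin) (simp add: coder_def lin_lin_ext)
  ultimately show ?thesis by simp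
qed

text \<open>For odd \<open>d\<close> the bracket is twice d(coder d), so it vanishes exactly when
  d(coder d) does. Coordinatewise this says that the square of the vector field kills theta_1,
  theta_2 and z.\<close>

lemma codifferential_iff:
  assumes "represents (p1, p2, q1, q2, r1, r2) d"
  shows "codifferential d \<longleftrightarrow> (let D = vf (p1, p2, q1, q2, r1, r2) in
    D (p1, 0, 0, q1) = 0 \<and> D (p2, 0, 0, q2) = 0 \<and> D (0, r1, r2, 0) = 0)"
proof -
  let ?P = "(p1, p2, q1, q2, r1, r2)"
  have d: "lin d" using assms by (simp add: represents_def)
  have 0: "fps_nth p1 0 = 0" "fps_nth p2 0 = 0" using assms by (simp_all add: represents_def)
  have zero: "(\<forall>x. ev (ser (vf ?P a)) x = 0) \<longleftrightarrow> vf ?P a = 0" for a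
  proof
    have s0: "ser (0, 0, 0, 0) J = (0 :: 'a)" for J
      by (simp add: ser_def split: prod.split)
    assume "\<forall>x. ev (ser (vf ?P a)) x = 0"
    then have "ser (vf ?P a) J = 0" for J by (metis ev_single mult_1)
    then show "vf ?P a = 0"
      using vf_reduced[OF assms] by (intro ser_eqI) (auto simp: s0 zero_prod_def)
  next
    assume "vf ?P a = 0"
    then show "\<forall>x. ev (ser (vf ?P a)) x = 0"
      by (simp add: ev_def ser_def zero_prod_def split: prod.split)
  qed
  have "codifferential d \<longleftrightarrow> (\<forall>x j. Poly_Mapping.lookup (d (coder d x)) j = 0)"
    using d represents_parity[OF assms]
    by (auto simp: codifferential_def bracket_def poly_mapping_eq_iff fun_eq_iff lookup_minus)
  also have "\<dots> \<longleftrightarrow> (\<forall>x. Poly_Mapping.lookup (d (coder d x)) W1 = 0) \<and>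
      (\<forall>x. Poly_Mapping.lookup (d (coder d x)) W2 = 0) \<and>
      (\<forall>x. Poly_Mapping.lookup (d (coder d x)) W3 = 0)"
    by (metis gen.exhaust)
  also have "\<dots> \<longleftrightarrow> (\<forall>x. ev (ser (vf ?P (p1, 0, 0, q1))) x = 0) \<and>
      (\<forall>x. ev (ser (vf ?P (p2, 0, 0, q2))) x = 0) \<and> (\<forall>x. ev (ser (vf ?P (0, r1, r2, 0))) x = 0)"
    using assms 0 by (simp add: represents_def ev_coder_ser[OF assms, symmetric] del: vf.simps)
  finally show ?thesis unfolding zero Let_def .
qed


section \<open>Coordinate changes\<close>

text \<open>The coordinate change \<open>\<theta>\<^sub>1 \<mapsto> \<theta>\<^sub>1 m11 + \<theta>\<^sub>2 m21\<close>, \<open>\<theta>\<^sub>2 \<mapsto> \<theta>\<^sub>1 m12 + \<theta>\<^sub>2 m22\<close>,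
  \<open>z \<mapsto> u + \<theta>\<^sub>1\<theta>\<^sub>2 q\<close>.\<close>

fun coord_change :: "'k::field_char_0 fps \<times> 'k fps \<times> 'k fps \<times> 'k fps \<times> 'k fps \<times> 'k fps \<Rightarrow> 'k sps \<Rightarrow> 'k sps" where
  "coord_change (u, m11, m12, m21, m22, q) (a0, a1, a2, a3) =
    (a0 oo u, m11 * (a1 oo u) + m12 * (a2 oo u), m21 * (a1 oo u) + m22 * (a2 oo u),
     q * (fps_deriv a0 oo u) + (m11 * m22 - m12 * m21) * (a3 oo u))"

fun coord_change_ok :: "'k::field_char_0 fps \<times> 'k fps \<times> 'k fps \<times> 'k fps \<times> 'k fps \<times> 'k fps \<Rightarrow> bool" where
  "coord_change_ok (u, m11, m12, m21, m22, q) \<longleftrightarrow>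
    fps_nth u 0 = 0 \<and> fps_nth u 1 \<noteq> 0 \<and> fps_nth (m11 * m22 - m12 * m21) 0 \<noteq> 0"

lemmas oo_simps = fps_compose_add_distrib fps_compose_sub_distrib fps_compose_uminus
  fps_compose_mult_distrib

lemma coord_change_smul:
  assumes "coord_change_ok C"
  shows "coord_change C (smul a b) = smul (coord_change C a) (coord_change C b)"
proof -
  obtain u m11 m12 m21 m22 q where C: "C = (u, m11, m12, m21, m22, q)" by (metis prod_cases6)
  obtain a0 a1 a2 a3 b0 b1 b2 b3 where ab: "a = (a0, a1, a2, a3)" "b = (b0, b1, b2, b3)"
    by (metis prod_cases4)
  have u: "fps_nth u 0 = 0" using assms by (simp add: C)
  show ?thesis by (simp add: C ab oo_simps(1-3) oo_simps(4)[OF u] algebra_simps)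
qed

lemma smul_reduced: "a \<in> reduced \<Longrightarrow> b \<in> reduced \<Longrightarrow> smul a b \<in> reduced"
  by (cases a, cases b) simp

lemma coord_change_reduced: "a \<in> reduced \<Longrightarrow> coord_change C a \<in> reduced"
  by (cases C, cases a) simp

lemma coord_change_of_parity:
  assumes "a \<in> reduced" "of_parity e a"
  shows "of_parity e (coord_change C a)"
proof -
  obtain u m11 m12 m21 m22 q where C: "C = (u, m11, m12, m21, m22, q)" by (metis prod_cases6)
  obtain a0 a1 a2 a3 where a: "a = (a0, a1, a2, a3)" by (metis prod_cases4)
  show ?thesis
    using assms by (cases "e = 0") (simp_all add: C a of_parity_1_iff)
qed

lemma coord_change_left_inverse:
  assumes "coord_change_ok C"
  shows "\<exists>C'. coord_change_ok C' \<and> (\<forall>a. coord_change C' (coord_change C a) = a)"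
proof -
  obtain u m11 m12 m21 m22 q where C: "C = (u, m11, m12, m21, m22, q)" by (metis prod_cases6)
  define \<Delta> where "\<Delta> = m11 * m22 - m12 * m21"
  define v where "v = fps_inv u"
  have u: "fps_nth u 0 = 0" "fps_nth u 1 \<noteq> 0" and D: "fps_nth \<Delta> 0 \<noteq> 0"
    using assms by (simp_all add: C \<Delta>_def)
  have v0: "fps_nth v 0 = 0" by (simp add: v_def fps_inv_def)
  have uv: "u oo v = fps_X" and vu: "v oo u = fps_X"
    using u by (simp_all add: v_def fps_inv fps_inv_right)
  have "fps_nth (v oo u) 1 = 1" by (simp add: vu)
  then have v1: "fps_nth v 1 \<noteq> 0" by (auto simp: fps_compose_nth v0)
  define i where "i = inverse \<Delta>"
  define j where "j = inverse (fps_deriv u)"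
  have i: "i * \<Delta> = 1" using D by (simp add: i_def inverse_mult_eq_1)
  have j: "j * fps_deriv u = 1" using u by (simp add: j_def inverse_mult_eq_1)
  note h = oo_simps(1-3)[symmetric] oo_simps(4)[OF v0, symmetric]
  have comp: "(a oo u) oo v = a" for a
    using fps_compose_assoc[OF v0 u(1), of a] by (simp add: uv)
  \<comment> \<open>The matrix part is the adjugate divided by \<Delta>, transported by
    \<open>v\<close>. In the last entry \<open>j\<close> removes the factor that the chain rule puts
    into the derivative of \<open>a0 oo u\<close>, so that the term with \<open>q\<close>
    cancels.\<close>
  let ?C' = "(v, (i * m22) oo v, (- (i * m12)) oo v, (- (i * m21)) oo v, (i * m11) oo v,
    (- (i * q * j)) oo v)"
  have det: "(i * m22 oo v) * (i * m11 oo v) - (- (i * m12) oo v) * (- (i * m21) oo v) = i oo v"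
  proof -
    have "i * m22 * (i * m11) - - (i * m12) * - (i * m21) = i * (i * \<Delta>)"
      by (simp add: \<Delta>_def algebra_simps)
    then show ?thesis unfolding h by (simp add: i)
  qed
  have ok: "coord_change_ok ?C'"
    using v0 v1 D unfolding coord_change_ok.simps det by (simp add: i_def)
  have "coord_change ?C' (coord_change C a) = a" for a
  proof -
    obtain a0 a1 a2 a3 where a: "a = (a0, a1, a2, a3)" by (metis prod_cases4)
    let ?a1 = "a1 oo u" and ?a2 = "a2 oo u" and ?a3 = "a3 oo u" and ?d = "fps_deriv a0 oo u"
    have "i * m22 * (m11 * ?a1 + m12 * ?a2) + - (i * m12) * (m21 * ?a1 + m22 * ?a2) = i * \<Delta> * ?a1"
      by (simp add: \<Delta>_def algebra_simps)
    then have 1: "(i * m22 oo v) * ((m11 * ?a1 + m12 * ?a2) oo v) +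
      (- (i * m12) oo v) * ((m21 * ?a1 + m22 * ?a2) oo v) = a1"
      unfolding h by (simp only: i mult_1 comp)
    have "- (i * m21) * (m11 * ?a1 + m12 * ?a2) + i * m11 * (m21 * ?a1 + m22 * ?a2) = i * \<Delta> * ?a2"
      by (simp add: \<Delta>_def algebra_simps)
    then have 2: "(- (i * m21) oo v) * ((m11 * ?a1 + m12 * ?a2) oo v) +
      (i * m11 oo v) * ((m21 * ?a1 + m22 * ?a2) oo v) = a2"
      unfolding h by (simp only: i mult_1 comp)
    have "- (i * q * j) * (?d * fps_deriv u) + i * (q * ?d + \<Delta> * ?a3) =
        i * \<Delta> * ?a3 + i * q * ?d * (1 - j * fps_deriv u)"
      by (simp add: algebra_simps)
    then have 3: "(- (i * q * j) oo v) * (fps_deriv (a0 oo u) oo v) +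
        (i oo v) * ((q * ?d + \<Delta> * ?a3) oo v) = a3"
      unfolding h fps_compose_deriv[OF u(1)] by (simp add: i j comp)
    show ?thesis
      unfolding C a coord_change.simps det \<Delta>_def[symmetric] by (simp only: 1 2 3 comp)
  qed
  with ok show ?thesis by blast
qed

text \<open>The left inverse has a left inverse of its own, and that one must agree with
  \<open>C\<close>.\<close>

lemma coord_change_inverse:
  assumes "coord_change_ok C"
  shows "\<exists>C'. coord_change_ok C' \<and> (\<forall>a. coord_change C' (coord_change C a) = a) \<and> (\<forall>a. coord_change C (coord_change C' a) = a)"
proof -
  obtain C' where C': "coord_change_ok C'" "\<And>a. coord_change C' (coord_change C a) = a"
    using coord_change_left_inverse[OF assms] by blast
  obtain C'' where "coord_change_ok C''" "\<And>a. coord_change C'' (coord_change C' a) = a"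
    using coord_change_left_inverse[OF C'(1)] by blast
  then have "coord_change C (coord_change C' a) = a" for a by (metis C'(2))
  with C' show ?thesis by blast
qed


subsection \<open>Transposes of coordinate changes\<close>

text \<open>These are the functionals on superseries that come from elements of S(W), which is
  smaller than its double dual.\<close>

definition finite_functional :: "('k::field_char_0 sps \<Rightarrow> 'k) \<Rightarrow> bool" where
  "finite_functional F \<longleftrightarrow> (\<exists>x. \<forall>a\<in>reduced. F a = ev (ser a) x)"

lemma finite_functional_add:
  assumes "finite_functional F" "finite_functional G"
  shows "finite_functional (\<lambda>a. F a + G a)"
proof -
  obtain x y where "\<forall>a\<in>reduced. F a = ev (ser a) x" "\<forall>a\<in>reduced. G a = ev (ser a) y"
    using assms by (auto simp: finite_functional_def)
  then show ?thesis
    unfolding finite_functional_def by (intro exI[of _ "x + y"]) (simp add: ev_add)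
qed

lemma finite_functional_mult:
  assumes "finite_functional F"
  shows "finite_functional (\<lambda>a. c * F a)"
proof -
  obtain x where "\<forall>a\<in>reduced. F a = ev (ser a) x"
    using assms by (auto simp: finite_functional_def)
  then show ?thesis
    unfolding finite_functional_def by (intro exI[of _ "scal c x"]) simp
qed

lemma finite_functional_sum:
  assumes "\<And>i. finite_functional (F i)"
  shows "finite_functional (\<lambda>a. \<Sum>i\<in>I. F i a)"
proof (induction I rule: infinite_finite_induct)
  case (insert i I)
  then show ?case using finite_functional_add[OF assms] by simp
qed (auto simp: finite_functional_def intro!: exI[of _ 0])

lemma finite_functional_coeff:
  "finite_functional (\<lambda>(a0, a1, a2, a3). fps_nth a0 n)"
  "finite_functional (\<lambda>(a0, a1, a2, a3). fps_nth a1 n)"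
  "finite_functional (\<lambda>(a0, a1, a2, a3). fps_nth a2 n)"
  "finite_functional (\<lambda>(a0, a1, a2, a3). fps_nth a3 n)"
proof -
  show "finite_functional (\<lambda>(a0, a1, a2, a3). fps_nth a0 n)"
  proof (cases n)
    case 0
    then show ?thesis unfolding finite_functional_def by (intro exI[of _ 0]) auto
  next
    case (Suc m)
    then show ?thesis unfolding finite_functional_def
      by (intro exI[of _ "Poly_Mapping.single (mono3 0 0 n) (1 / fact n)"])
        (auto simp del: fact_Suc)
  qed
  show "finite_functional (\<lambda>(a0, a1, a2, a3). fps_nth a1 n)"
    unfolding finite_functional_def
    by (intro exI[of _ "Poly_Mapping.single (mono3 (Suc 0) 0 n) (1 / fact n)"]) auto
  show "finite_functional (\<lambda>(a0, a1, a2, a3). fps_nth a2 n)"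
    unfolding finite_functional_def
    by (intro exI[of _ "Poly_Mapping.single (mono3 0 (Suc 0) n) (1 / fact n)"]) auto
  show "finite_functional (\<lambda>(a0, a1, a2, a3). fps_nth a3 n)"
    unfolding finite_functional_def
    by (intro exI[of _ "Poly_Mapping.single (mono3 (Suc 0) (Suc 0) n) (1 / fact n)"]) auto
qed

text \<open>The coefficient of index n of a composition involves the coefficients of the outer
  series only up to index n.\<close>

lemma finite_functional_mult_compose:
  assumes "\<And>n. finite_functional (\<lambda>a. fps_nth (f a) n)"
  shows "finite_functional (\<lambda>a. fps_nth (m * (f a oo u)) n)"
proof -
  have "finite_functional (\<lambda>a. \<Sum>i=0..n. fps_nth m i *
      (\<Sum>j=0..n - i. fps_nth (u ^ j) (n - i) * fps_nth (f a) j))"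
    by (intro finite_functional_sum finite_functional_mult assms)
  then show ?thesis by (simp add: fps_mult_nth fps_compose_nth mult.commute)
qed

lemma finite_functional_coord_change: "finite_functional (\<lambda>a. ser (coord_change C a) J)"
proof -
  obtain u m11 m12 m21 m22 q where C: "C = (u, m11, m12, m21, m22, q)" by (metis prod_cases6)
  define c0 c1 c2 c3 :: "'a sps \<Rightarrow> 'a fps"
    where "c0 = (\<lambda>(a0, a1, a2, a3). a0)" and "c1 = (\<lambda>(a0, a1, a2, a3). a1)"
      and "c2 = (\<lambda>(a0, a1, a2, a3). a2)" and "c3 = (\<lambda>(a0, a1, a2, a3). a3)"
  have c: "finite_functional (\<lambda>a. fps_nth (c0 a) n)" "finite_functional (\<lambda>a. fps_nth (c1 a) n)"
    "finite_functional (\<lambda>a. fps_nth (c2 a) n)" "finite_functional (\<lambda>a. fps_nth (c3 a) n)" for n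
    using finite_functional_coeff[of n]
    by (simp_all add: c0_def c1_def c2_def c3_def case_prod_unfold)
  have d: "finite_functional (\<lambda>a. fps_nth (fps_deriv (c0 a)) n)" for n
    unfolding fps_deriv_nth by (intro finite_functional_mult c)
  note ff = finite_functional_add finite_functional_mult finite_functional_mult_compose c d
  have eq: "coord_change C a = (1 * (c0 a oo u), m11 * (c1 a oo u) + m12 * (c2 a oo u),
      m21 * (c1 a oo u) + m22 * (c2 a oo u),
      q * (fps_deriv (c0 a) oo u) + (m11 * m22 - m12 * m21) * (c3 a oo u))" for a
    by (cases a) (simp add: C c0_def c1_def c2_def c3_def)
  show ?thesis
    by (cases J rule: mono_cases; simp only: eq ser_simps fps_add_nth; intro ff)
qed

lemma coord_change_transpose:
  fixes C :: "'a::field_char_0 fps \<times> 'a fps \<times> 'a fps \<times> 'a fps \<times> 'a fps \<times> 'a fps"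
  shows
  "\<exists>h. lin h \<and> (\<forall>a\<in>reduced. \<forall>x. ev (ser a) (h x) = ev (ser (coord_change C a)) x)"
proof -
  have "\<forall>J. \<exists>x. \<forall>a\<in>reduced. ser (coord_change C a) J = ev (ser a) x"
    using finite_functional_coord_change unfolding finite_functional_def by blast
  then obtain X where "\<forall>J. \<forall>a\<in>reduced. ser (coord_change C a) J = ev (ser a) (X J)" by metis
  then have "ev (ser a) (lin_ext X x) = ev (ser (coord_change C a)) x" if "a \<in> reduced" for a x
    using that by (simp add: ev_lin_ext ev_def[of _ x])
  then show ?thesis using lin_lin_ext[of X] by blast
qed

text \<open>Multiplicativity of \<open>C\<close> dualises to compatibility with the
  comultiplication, and the inverse coordinate change transposes to the inverse map.\<close>

lemma coord_change_transpose_automorphism: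
  fixes h :: "'k::field_char_0 symW \<Rightarrow> 'k symW"
  assumes C: "coord_change_ok C" and h: "lin h"
    and tr: "\<And>a x. a \<in> reduced \<Longrightarrow> ev (ser a) (h x) = ev (ser (coord_change C a)) x"
  shows "coalgebra_automorphism h"
proof -
  obtain C' where C': "coord_change_ok C'" "\<And>a. coord_change C' (coord_change C a) = a" "\<And>a. coord_change C (coord_change C' a) = a"
    using coord_change_inverse[OF C] by blast
  obtain h' where h': "\<And>a x. a \<in> reduced \<Longrightarrow> ev (ser a) (h' x :: 'k symW) = ev (ser (coord_change C' a)) x"
    using coord_change_transpose[of C'] by blast
  have "h (h' x) = x" "h' (h x) = x" for x
    by (rule ev_ser_eqI; simp add: tr h' coord_change_reduced C')+
  then have "bij h" by (intro bij_betwI[of _ _ _ h']) auto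
  moreover have "has_parity mpar mpar 0 h"
    unfolding has_parity_def
  proof (intro allI ballI)
    fix c and x :: "'k symW" assume x: "x \<in> homog mpar c"
    have "mpar J = c" if J: "J \<in> Poly_Mapping.keys (h x)" for J
    proof -
      \<comment> \<open>The series dual to \<open>J\<close> has the parity of \<open>J\<close>, and
        \<open>C\<close> preserves it; so only monomials of that parity contribute to the
        coefficient of \<open>J\<close>.\<close>
      obtain a :: "'k sps" where a: "a \<in> reduced" "(\<lambda>I. of_bool (I = J)) = ser a" using ser_surj by blast
      have "ev (ser (coord_change C a)) x \<noteq> 0"
        using J by (simp add: in_keys_iff lookup_eq_ev a tr)
      then obtain I where I: "I \<in> Poly_Mapping.keys x" "ser (coord_change C a) I \<noteq> 0"
        using ev_nonzero_key by blast
      have "of_parity (mpar J) a" unfolding of_parity_def a(2)[symmetric] by auto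
      then have "of_parity (mpar J) (coord_change C a)" using a(1) by (simp add: coord_change_of_parity)
      then have "mpar I = mpar J" using I by (auto simp: of_parity_def)
      then show ?thesis using x I by (simp add: homog_def)
    qed
    then show "h x \<in> homog mpar (c + 0)" by (simp add: homog_def)
  qed
  moreover have "comult (h x) = tensor_map h h (comult x)" for x
    by (rule ev2_ser_eqI)
      (simp add: ev2_comult_ser tr smul_reduced coord_change_smul[OF C] coord_change_reduced ev2_tensor_map)
  ultimately show ?thesis using h by (simp add: coalgebra_automorphism_def)
qed

section \<open>Inverses of automorphisms and the criterion for equivalence\<close>

lemma parity_decomposition:
  fixes x :: "'k::field symW"
  obtains x' x'' where "x = x' + x''" "x' \<in> homog mpar c" "x'' \<in> homog mpar (c + 1)"
proof -
  define part where "part e = lin_ext (\<lambda>J. if mpar J = e then basis J else (0 :: 'k symW))" for e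
  have part: "Poly_Mapping.lookup (part e x) J = (if mpar J = e then Poly_Mapping.lookup x J else 0)" for e J
  proof -
    have "Poly_Mapping.lookup (part e x) J =
        ev (\<lambda>I. if mpar J = e then of_bool (I = J) else 0) x"
      unfolding lookup_eq_ev[of "part e x" J] unfolding part_def ev_lin_ext
      by (rule arg_cong[where f = "\<lambda>f. ev f x"]) auto
    then show ?thesis by (simp add: lookup_eq_ev ev_def[of "\<lambda>I. 0"])
  qed
  show ?thesis
  proof (rule that[of "part c x" "part (c + 1) x"])
    have "c + 1 \<noteq> c" by simp
    moreover have "mpar J = c \<or> mpar J = c + 1" for J by (cases "c = 0") auto
    ultimately show "x = part c x + part (c + 1) x"
      by (intro poly_mapping_eqI) (metis lookup_add part add.left_neutral add.right_neutral)
    show "part c x \<in> homog mpar c" "part (c + 1) x \<in> homog mpar (c + 1)"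
      unfolding homog_def by (auto simp del: add_bit_eq_xor simp: in_keys_iff part split: if_splits)
  qed
qed

lemma homog_disjoint:
  assumes "x \<in> homog p c" "x \<in> homog p (c + 1)"
  shows "x = 0"
proof -
  have "c \<noteq> c + 1" by simp
  then have "Poly_Mapping.keys x = {}" using assms unfolding homog_def by auto
  then show ?thesis by simp
qed

lemma homog_diff: "x \<in> homog p c \<Longrightarrow> y \<in> homog p c \<Longrightarrow> x - y \<in> homog p c"
  using Poly_Mapping.keys_diff[of x y] unfolding homog_def by auto

lemma automorphism_inv:
  fixes g :: "'k::field symW \<Rightarrow> 'k symW"
  assumes "coalgebra_automorphism g"
  shows "coalgebra_automorphism (inv g)"
proof -
  have g: "lin g" "bij g" "has_parity mpar mpar 0 g"
    and co: "\<And>x. comult (g x) = tensor_map g g (comult x)"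
    using assms by (auto simp: coalgebra_automorphism_def)
  have gi: "g (inv g x) = x" and ig: "inv g (g x) = x" for x
    using g(2) by (simp_all add: bij_is_surj surj_f_inv_f bij_is_inj)
  have lin: "lin (inv g)"
  proof (rule linI)
    show "inv g (x + y) = inv g x + inv g y" for x y
      by (rule injD[OF bij_is_inj[OF g(2)]]) (simp add: lin_add[OF g(1)] gi)
    show "inv g (scal c x) = scal c (inv g x)" for c x
      by (rule injD[OF bij_is_inj[OF g(2)]]) (simp add: lin_scal[OF g(1)] gi)
  qed
  have "tensor_map (inv g) (inv g) (comult y) = comult (inv g y)" for y
  proof -
    have "inv g \<circ> g = id" using ig by auto
    then show ?thesis
      using co[of "inv g y"] by (simp add: gi tensor_map_comp[OF lin lin] tensor_map_id)
  qed
  moreover have "has_parity mpar mpar 0 (inv g)"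
    unfolding has_parity_def
  proof (intro allI ballI)
    fix c and y :: "'k symW" assume y: "y \<in> homog mpar c"
    obtain x' x'' where x: "inv g y = x' + x''" "x' \<in> homog mpar c" "x'' \<in> homog mpar (c + 1)"
      by (rule parity_decomposition)
    have g': "g x' \<in> homog mpar c" "g x'' \<in> homog mpar (c + 1)"
      using x(2,3) g(3) unfolding has_parity_def by (metis add.right_neutral)+
    \<comment> \<open>As \<open>y\<close> and \<open>g x'\<close> have parity \<open>c\<close>, so
      has \<open>g x''\<close>; it also has the opposite parity, hence is 0, and injectivity of
      \<open>g\<close> gives \<open>x'' = 0\<close>.\<close>
    have "y = g x' + g x''" using gi[of y] by (simp add: x(1) lin_add[OF g(1)])
    then have "g x'' = y - g x'" by simp
    then have "g x'' \<in> homog mpar c" using homog_diff[OF y g'(1)] by simp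
    from homog_disjoint[OF this g'(2)] have "x'' = 0"
      using ig[of x''] ig[of 0] by (simp add: lin_zero[OF g(1)])
    then show "inv g y \<in> homog mpar (c + 0)" using x(1,2) by (simp only: add.right_neutral)
  qed
  ultimately show ?thesis
    using lin bij_imp_bij_inv[OF g(2)] by (simp add: coalgebra_automorphism_def)
qed

text \<open>The transpose \<open>h\<close> of \<open>C\<close> carries \<open>coder d\<close> to
  \<open>coder d'\<close>, which is the direction opposite to the one in \<open>equivalent\<close>;
  hence the automorphism to use is the inverse of \<open>h\<close>.\<close>

lemma equivalentI:
  assumes d: "codifferential d" "represents P d" and d': "codifferential d'" "represents P' d'"
    and C: "coord_change_ok C" and comm: "\<And>a. a \<in> reduced \<Longrightarrow> vf P (coord_change C a) = coord_change C (vf P' a)"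
  shows "equivalent d d'"
proof -
  obtain h where h: "lin h" "\<And>a x. a \<in> reduced \<Longrightarrow> ev (ser a) (h x) = ev (ser (coord_change C a)) x"
    using coord_change_transpose[of C] by blast
  have auto: "coalgebra_automorphism h" using coord_change_transpose_automorphism[OF C h] by blast
  then have bij: "bij h" by (simp add: coalgebra_automorphism_def)
  have "coder d' (h x) = h (coder d x)" for x
    by (rule ev_ser_eqI)
      (simp add: h ev_coder_ser[OF d(2)] ev_coder_ser[OF d'(2)] coord_change_reduced vf_reduced[OF d'(2)] comm)
  then have "coder d' = h \<circ> coder d \<circ> inv h"
    by (simp add: fun_eq_iff, metis bij bij_is_surj surj_f_inv_f)
  then have "coder d' = inv (inv h) \<circ> coder d \<circ> inv h"
    by (simp add: inv_inv_eq[OF bij])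
  then show ?thesis
    unfolding equivalent_def using d(1) d'(1) automorphism_inv[OF auto] by blast
qed


section \<open>Normal forms\<close>

lemma fps_linear_ode_unique:
  fixes f :: "'k::field_char_0 fps"
  assumes ode: "fps_deriv f = w * f" and 0: "fps_nth f 0 = 0"
  shows "f = 0"
proof -
  have "fps_nth f n = 0" for n
  proof (induction n rule: less_induct)
    case (less n)
    show ?case
    proof (cases n)
      case (Suc m)
      \<comment> \<open>Coefficient m of the equation expresses m + 1 times the next coefficient of
        \<open>f\<close> through the earlier ones, and m + 1 is invertible.\<close>
      have "fps_nth (fps_deriv f) m = (\<Sum>i=0..m. fps_nth w i * fps_nth f (m - i))"
        unfolding ode fps_mult_nth ..
      also have "\<dots> = 0" using less Suc by (intro sum.neutral) auto
      finally show ?thesis by (simp add: Suc del: of_nat_Suc)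
    qed (use 0 in simp)
  qed
  then show ?thesis by (simp add: fps_eq_iff)
qed

lemma fps_linear_ode_exists:
  fixes w :: "'k::field_char_0 fps"
  shows "\<exists>h. fps_deriv h = w * h \<and> fps_nth h 0 = 1"
proof (intro exI conjI)
  \<comment> \<open>The exponential of the integral of \<open>w\<close>; the integral is taken
    without constant term so that it can be substituted.\<close>
  let ?h = "fps_exp 1 oo fps_integral w 0"
  show "fps_deriv ?h = w * ?h" by (simp add: fps_compose_deriv fps_deriv_fps_integral mult.commute)
  show "fps_nth ?h 0 = 1" by simp
qed

section \<open>Vector fields of the two normal forms\<close>

lemma lookup_phi:
  "Poly_Mapping.lookup (phi (i1, i2, i3) j x) i =
    ev (\<lambda>J. if i = j \<and> Rep_mono J = (i1, i2, i3) then of_nat (fact i1 * fact i2 * fact i3) else 0) x"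
  unfolding lookup_eq_ev[of "phi _ _ _"] unfolding phi_def ev_lin_ext
  by (rule arg_cong[where f = "\<lambda>f. ev f x"]) auto

lemma represents_psi1: "represents (0, 0, 0, 0, 0, 1) (psi (0, 1, 0) W3 :: 'k::field_char_0 cochain)"
proof -
  have "(\<lambda>J. if Rep_mono J = (0, 1, 0) then of_nat (fact 0 * fact 1 * fact 0) else 0) =
      (ser (0, 0, 1, 0) :: mono \<Rightarrow> 'k)"
  proof
    fix J
    show "(if Rep_mono J = (0, 1, 0) then of_nat (fact 0 * fact 1 * fact 0) else 0) =
        (ser (0, 0, 1, 0) J :: 'k)"
      by (cases J rule: mono_cases) auto
  qed
  moreover have "(\<lambda>J. 0) = (ser (0, 0, 0, 0) :: mono \<Rightarrow> 'k)"
    by (rule ext) (simp add: ser_def split: prod.split)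
  moreover have "lin (psi (0, 1, 0) W3 :: 'k cochain)" by (simp add: phi_def lin_lin_ext)
  ultimately show ?thesis
    unfolding represents_def lookup_phi by (simp del: One_nat_def)
qed

lemma represents_psi2: "represents (fps_X, 0, 0, 0, 0, 0) (psi (0, 0, 1) W1 :: 'k::field_char_0 cochain)"
proof -
  have "(\<lambda>J. if Rep_mono J = (0, 0, 1) then of_nat (fact 0 * fact 0 * fact 1) else 0) =
      (ser (fps_X, 0, 0, 0) :: mono \<Rightarrow> 'k)"
  proof
    fix J
    show "(if Rep_mono J = (0, 0, 1) then of_nat (fact 0 * fact 0 * fact 1) else 0) =
        (ser (fps_X, 0, 0, 0) J :: 'k)"
      by (cases J rule: mono_cases) auto
  qed
  moreover have "(\<lambda>J. 0) = (ser (0, 0, 0, 0) :: mono \<Rightarrow> 'k)"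
    by (rule ext) (simp add: ser_def split: prod.split)
  moreover have "lin (psi (0, 0, 1) W1 :: 'k cochain)" by (simp add: phi_def lin_lin_ext)
  ultimately show ?thesis
    unfolding represents_def lookup_phi by (simp del: One_nat_def)
qed

lemma codifferential_psi:
  "codifferential (psi (0, 1, 0) W3 :: 'k::field_char_0 cochain)"
  "codifferential (psi (0, 0, 1) W1 :: 'k::field_char_0 cochain)"
  unfolding codifferential_iff[OF represents_psi1] codifferential_iff[OF represents_psi2]
  by (simp_all add: zero_prod_def)

text \<open>The components of D^2 = 0 that are not trivially zero: the first two come from z, the
  next two from theta_1, the last two from theta_2.\<close>

lemma codifferential_equations:
  assumes "codifferential d" "represents (p1, p2, q1, q2, r1, r2) d"
  shows "p1 * r1 + p2 * r2 = 0"
    and "q1 * r1 + q2 * r2 + r1 * fps_deriv r2 - r2 * fps_deriv r1 = 0"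
    and "r1 * fps_deriv p1 = p2 * q1" "r2 * fps_deriv p1 = - (p1 * q1)"
    and "r1 * fps_deriv p2 = p2 * q2" "r2 * fps_deriv p2 = - (p1 * q2)"
  using assms(1) unfolding codifferential_iff[OF assms(2)] Let_def
  by (simp_all add: zero_prod_def algebra_simps eq_neg_iff_add_eq_0)

text \<open>If \<open>z\<close> is moved by the vector field, then \<open>z\<close> and its image \<open>\<theta>\<^sub>1 r\<^sub>1 + \<theta>\<^sub>2 r\<^sub>2\<close> are two of the
  new coordinates, and the third one is an invariant \<open>\<theta>\<^sub>1 \<alpha> + \<theta>\<^sub>2 \<beta>\<close>.\<close>

lemma equivalent_psi1:
  assumes d: "codifferential d" "represents (p1, p2, q1, q2, r1, r2) d"
    and p: "p1 = 0" "p2 = 0"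
    and inv: "q1 * \<alpha> + q2 * \<beta> + r1 * fps_deriv \<beta> - r2 * fps_deriv \<alpha> = 0"
    and indep: "fps_nth (\<alpha> * r2 - r1 * \<beta>) 0 \<noteq> 0"
  shows "equivalent d (psi (0, 1, 0) W3)"
proof (rule equivalentI[OF d codifferential_psi(1) represents_psi1])
  note eq = codifferential_equations[OF d]
  show "coord_change_ok (fps_X, \<alpha>, r1, \<beta>, r2, 0)" using indep by simp
  fix a :: "'a sps"
  obtain a0 a1 a2 a3 where a: "a = (a0, a1, a2, a3)" by (metis prod_cases4)
  \<comment> \<open>In the theta_1 theta_2 component the coefficient of \<open>a1\<close> vanishes
    by \<open>inv\<close> and that of \<open>a2\<close> because D^2 z = 0; the derivative of
    \<open>a1\<close> survives, multiplied by the determinant.\<close>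
  have "q1 * (\<alpha> * a1 + r1 * a2) + q2 * (\<beta> * a1 + r2 * a2) +
      r1 * fps_deriv (\<beta> * a1 + r2 * a2) - r2 * fps_deriv (\<alpha> * a1 + r1 * a2) =
    a1 * (q1 * \<alpha> + q2 * \<beta> + r1 * fps_deriv \<beta> - r2 * fps_deriv \<alpha>) +
    a2 * (q1 * r1 + q2 * r2 + r1 * fps_deriv r2 - r2 * fps_deriv r1) -
    (\<alpha> * r2 - r1 * \<beta>) * fps_deriv a1"
    by (simp add: algebra_simps)
  also have "\<dots> = - ((\<alpha> * r2 - r1 * \<beta>) * fps_deriv a1)" by (simp add: inv eq(2))
  finally show "vf (p1, p2, q1, q2, r1, r2) (coord_change (fps_X, \<alpha>, r1, \<beta>, r2, 0) a) =
      coord_change (fps_X, \<alpha>, r1, \<beta>, r2, 0) (vf (0, 0, 0, 0, 0, 1) a)"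
    by (simp add: a p fps_compose_uminus)
qed

lemma fps_dvd_of_simple_zero:
  fixes f g :: "'k::field fps"
  assumes "fps_nth f 0 = 0" "fps_nth f 1 \<noteq> 0" "fps_nth g 0 = 0"
  shows "f dvd g"
proof -
  have "subdegree f = 1" using assms by (intro subdegreeI) auto
  moreover have "g = 0 \<or> subdegree g \<ge> 1"
    using assms nth_subdegree_nonzero[of g] by (metis less_one not_less)
  moreover have "f \<noteq> 0" using assms by auto
  ultimately show ?thesis by (cases "g = 0") (auto simp: fps_dvd_iff)
qed

text \<open>If some \<open>p\<^sub>i\<close> has a linear term, then the image \<open>p\<^sub>i + \<theta>\<^sub>1\<theta>\<^sub>2 q\<^sub>i\<close> of \<open>\<theta>\<^sub>i\<close> can replace the
  coordinate \<open>z\<close>, and subtracting a multiple of \<open>\<theta>\<^sub>i\<close> makes the other odd coordinate invariant.\<close>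

lemma equivalent_psi2_fst:
  assumes d: "codifferential d" "represents (p1, p2, q1, q2, r1, r2) d"
    and p: "fps_nth p1 1 \<noteq> 0"
  shows "equivalent d (psi (0, 0, 1) W1)"
proof -
  note eq = codifferential_equations[OF d]
  have p0: "fps_nth p1 0 = 0" "fps_nth p2 0 = 0" using d(2) by (simp_all add: represents_def)
  have p_nz: "p1 \<noteq> 0" using p by auto
  obtain s where s: "p2 = p1 * s" using fps_dvd_of_simple_zero[OF p0(1) p p0(2)] by (elim dvdE)
  have ds: "fps_deriv p2 = fps_deriv p1 * s + p1 * fps_deriv s" by (simp add: s algebra_simps)
  have "p1 * (r1 + s * r2) = 0" using eq(1) by (simp add: s algebra_simps)
  then have r1: "r1 = - (s * r2)" using p_nz by (simp add: eq_neg_iff_add_eq_0)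
  \<comment> \<open>The factor in parentheses is the theta_1 theta_2 coefficient of D(theta_2 - s
    theta_1). The equations yield it only multiplied by \<open>p1\<close>, which cancels in a
    domain.\<close>
  have "p1 * (q2 - s * q1 + fps_deriv s * r2) = 0"
    using eq(4,6) ds by algebra
  then have inv: "q2 - s * q1 + fps_deriv s * r2 = 0" using p_nz by simp
  \<comment> \<open>theta_1 stays, theta_2 becomes theta_2 - s theta_1, and z becomes D theta_1 = p1
    + theta_1 theta_2 q1.\<close>
  let ?C = "(p1, 1, - s, 0, 1, q1)"
  show ?thesis
  proof (rule equivalentI[OF d codifferential_psi(2) represents_psi2])
    show "coord_change_ok ?C" using p p0 by simp
    fix a :: "'a sps"
    obtain a0 a1 a2 a3 where a: "a = (a0, a1, a2, a3)" by (metis prod_cases4)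
    define A1 A2 A3 D0 D1 D2 where "A1 = a1 oo p1" and "A2 = a2 oo p1" and "A3 = a3 oo p1"
      and "D0 = fps_deriv a0 oo p1" and "D1 = fps_deriv a1 oo p1" and "D2 = fps_deriv a2 oo p1"
    note A = A1_def[symmetric] A2_def[symmetric] A3_def[symmetric]
      D0_def[symmetric] D1_def[symmetric] D2_def[symmetric]
    have dA: "fps_deriv A1 = D1 * fps_deriv p1" "fps_deriv A2 = D2 * fps_deriv p1"
      by (simp_all add: A1_def A2_def D1_def D2_def fps_compose_deriv[OF p0(1)])
    \<comment> \<open>One identity for each of the four components of the intertwining relation,
      after the chain rule.\<close>
    have "p1 * (A1 - s * A2) + p2 * A2 = p1 * A1" unfolding s by algebra
    moreover have "r1 * (D0 * fps_deriv p1) - p2 * (q1 * D0 + A3) = - (s * (p1 * A3))"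
      using eq(4) unfolding r1 s by algebra
    moreover have "r2 * (D0 * fps_deriv p1) + p1 * (q1 * D0 + A3) = p1 * A3"
      using eq(4) by algebra
    moreover have "q1 * (A1 - s * A2) + q2 * A2 + r1 * (D2 * fps_deriv p1) -
        r2 * (D1 * fps_deriv p1 - (fps_deriv s * A2 + s * (D2 * fps_deriv p1))) =
      q1 * (A1 + p1 * D1)"
      using inv eq(4) unfolding r1 by algebra
    ultimately show "vf (p1, p2, q1, q2, r1, r2) (coord_change ?C a) = coord_change ?C (vf (fps_X, 0, 0, 0, 0, 0) a)"
      by (simp add: a oo_simps(1-3) oo_simps(4)[OF p0(1)] fps_compose_deriv[OF p0(1)] A dA p0
          ac_simps)
  qed
qed

text \<open>The mirror image of the preceding case; since the normal form moves theta_1, the two odd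
  coordinates are also interchanged.\<close>

lemma equivalent_psi2_snd:
  assumes d: "codifferential d" "represents (p1, p2, q1, q2, r1, r2) d"
    and p: "fps_nth p2 1 \<noteq> 0"
  shows "equivalent d (psi (0, 0, 1) W1)"
proof -
  note eq = codifferential_equations[OF d]
  have p0: "fps_nth p1 0 = 0" "fps_nth p2 0 = 0" using d(2) by (simp_all add: represents_def)
  have p_nz: "p2 \<noteq> 0" using p by auto
  obtain s where s: "p1 = p2 * s" using fps_dvd_of_simple_zero[OF p0(2) p p0(1)] by (elim dvdE)
  have ds: "fps_deriv p1 = fps_deriv p2 * s + p2 * fps_deriv s" by (simp add: s algebra_simps)
  have "p2 * (r2 + s * r1) = 0" using eq(1) by (simp add: s algebra_simps)
  then have r2: "r2 = - (s * r1)" using p_nz by (simp add: eq_neg_iff_add_eq_0)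
  have "p2 * (q1 - s * q2 - fps_deriv s * r1) = 0"
    using eq(3,5) ds by algebra
  then have inv: "q1 - s * q2 - fps_deriv s * r1 = 0" using p_nz by simp
  \<comment> \<open>theta_1 becomes theta_2, theta_2 becomes theta_1 - s theta_2, and z becomes D
    theta_2 = p2 + theta_1 theta_2 q2.\<close>
  let ?C = "(p2, 0, 1, 1, - s, q2)"
  show ?thesis
  proof (rule equivalentI[OF d codifferential_psi(2) represents_psi2])
    show "coord_change_ok ?C" using p p0 by simp
    fix a :: "'a sps"
    obtain a0 a1 a2 a3 where a: "a = (a0, a1, a2, a3)" by (metis prod_cases4)
    define A1 A2 A3 D0 D1 D2 where "A1 = a1 oo p2" and "A2 = a2 oo p2" and "A3 = a3 oo p2"
      and "D0 = fps_deriv a0 oo p2" and "D1 = fps_deriv a1 oo p2" and "D2 = fps_deriv a2 oo p2"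
    note A = A1_def[symmetric] A2_def[symmetric] A3_def[symmetric]
      D0_def[symmetric] D1_def[symmetric] D2_def[symmetric]
    have dA: "fps_deriv A1 = D1 * fps_deriv p2" "fps_deriv A2 = D2 * fps_deriv p2"
      by (simp_all add: A1_def A2_def D1_def D2_def fps_compose_deriv[OF p0(2)])
    have "p1 * A2 + p2 * (A1 - s * A2) = p2 * A1" unfolding s by algebra
    moreover have "r1 * (D0 * fps_deriv p2) - p2 * (q2 * D0 - A3) = p2 * A3"
      using eq(5) by algebra
    moreover have "r2 * (D0 * fps_deriv p2) + p1 * (q2 * D0 - A3) = - (s * (p2 * A3))"
      using eq(5) unfolding r2 s by algebra
    moreover have "q1 * A2 + q2 * (A1 - s * A2) +
        r1 * (D1 * fps_deriv p2 - (fps_deriv s * A2 + s * (D2 * fps_deriv p2))) -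
        r2 * (D2 * fps_deriv p2) =
      q2 * (A1 + p2 * D1)"
      using inv eq(5) unfolding r2 by algebra
    ultimately show "vf (p1, p2, q1, q2, r1, r2) (coord_change ?C a) = coord_change ?C (vf (fps_X, 0, 0, 0, 0, 0) a)"
      by (simp add: a oo_simps(1-3) oo_simps(4)[OF p0(2)] fps_compose_deriv[OF p0(2)] A dA p0
          ac_simps)
  qed
qed

text \<open>Division by the unit \<open>r2\<close> (or \<open>r1\<close>) turns D^2 theta_1 = 0 (or
  D^2 theta_2 = 0) into a linear differential equation with zero initial value, so \<open>p1\<close>
  and \<open>p2\<close> vanish. The invariant coordinate solves a similar equation with initial
  value 1.\<close>

lemma equivalent_psi1_of_unit:
  assumes d: "codifferential d" "represents (p1, p2, q1, q2, r1, r2) d"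
    and r: "fps_nth r1 0 \<noteq> 0 \<or> fps_nth r2 0 \<noteq> 0"
  shows "equivalent d (psi (0, 1, 0) W3)"
proof (cases "fps_nth r2 0 = 0")
  case False
  note eq = codifferential_equations[OF d]
  have p0: "fps_nth p1 0 = 0" using d(2) by (simp add: represents_def)
  define w where "w = inverse r2"
  have w: "w * r2 = 1" using False by (simp add: w_def inverse_mult_eq_1)
  have "fps_deriv p1 = - (q1 * w) * p1" using w eq(4) by algebra
  then have p1: "p1 = 0" using p0 by (rule fps_linear_ode_unique)
  then have p2: "p2 = 0" using eq(1) False by auto
  \<comment> \<open>A multiple of theta_1 alone suffices as invariant: it is independent of Dz
    because \<open>r2\<close> is a unit.\<close>
  obtain \<alpha> where \<alpha>: "fps_deriv \<alpha> = (q1 * w) * \<alpha>" "fps_nth \<alpha> 0 = 1"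
    using fps_linear_ode_exists[of "q1 * w"] by blast
  have "q1 * \<alpha> - r2 * fps_deriv \<alpha> = 0" using \<alpha>(1) w by algebra
  then show ?thesis using False \<alpha>(2) by (intro equivalent_psi1[OF d p1 p2, of \<alpha> 0]) simp_all
next
  case True
  note eq = codifferential_equations[OF d]
  have p0: "fps_nth p2 0 = 0" using d(2) by (simp add: represents_def)
  have r1: "fps_nth r1 0 \<noteq> 0" using r True by simp
  define w where "w = inverse r1"
  have w: "w * r1 = 1" using r1 by (simp add: w_def inverse_mult_eq_1)
  have "fps_deriv p2 = (q2 * w) * p2" using w eq(5) by algebra
  then have p2: "p2 = 0" using p0 by (rule fps_linear_ode_unique)
  then have p1: "p1 = 0" using eq(1) r1 by auto
  obtain \<beta> where \<beta>: "fps_deriv \<beta> = - (q2 * w) * \<beta>" "fps_nth \<beta> 0 = 1"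
    using fps_linear_ode_exists[of "- (q2 * w)"] by blast
  have "q2 * \<beta> + r1 * fps_deriv \<beta> = 0" using \<beta>(1) w by algebra
  then show ?thesis using r1 \<beta>(2) by (intro equivalent_psi1[OF d p1 p2, of 0 \<beta>]) simp_all
qed

text \<open>By parity d_1 maps w_3 into the span of w_1, w_2 and these into the span of w_3; the
  four entries are the listed coefficients.\<close>

lemma component_1_eq_0:
  assumes P: "represents (p1, p2, q1, q2, r1, r2) d"
    and 0: "fps_nth p1 1 = 0" "fps_nth p2 1 = 0" "fps_nth r1 0 = 0" "fps_nth r2 0 = 0"
  shows "component 1 d = (\<lambda>_. 0)"
proof -
  have "d (basis I) = 0" if I: "mdeg I = 1" for I
  proof (rule poly_mapping_eqI)
    fix j
    show "Poly_Mapping.lookup (d (basis I)) j = Poly_Mapping.lookup 0 j"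
      using P 0 I by (cases j; cases I rule: mono_cases) (simp_all add: represents_def mdeg_def)
  qed
  then have "(\<lambda>I. if mdeg I = 1 then d (basis I) else 0) = (\<lambda>_. 0)" by auto
  moreover have "lin_ext (\<lambda>_. 0) x = (0 :: 'a vecW)" for x :: "'a symW"
    by (rule ev_eqI) (simp add: ev_lin_ext ev_def[of "\<lambda>_. 0"])
  ultimately show ?thesis by (simp add: component_def fun_eq_iff)
qed

section \<open>Inequivalence of the two normal forms\<close>

lemma coder_psi2_odd_primitive:
  fixes z :: "'k::field_char_0 symW"
  assumes z: "z \<in> homog mpar 1" "comult z = 0"
  shows "coder (psi (0, 0, 1) W1) z = 0"
proof (rule ev_ser_eqI)
  fix a :: "'k sps" assume a: "a \<in> reduced"
  obtain a0 a1 a2 a3 where a_eq: "a = (a0, a1, a2, a3)" by (metis prod_cases4)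
  \<comment> \<open>The even summand \<open>fps_X * a1\<close> vanishes on odd elements. The other
    one is theta_2 times \<open>fps_X * a3\<close>, and a product vanishes on primitive
    elements.\<close>
  have "ev (ser a) (coder (psi (0, 0, 1) W1) z) = ev (ser (fps_X * a1, 0, fps_X * a3, 0)) z"
    unfolding ev_coder_ser[OF represents_psi2 a] by (simp add: a_eq)
  also have "\<dots> = ev (ser (0, 0, fps_X * a3, 0)) z"
    unfolding ev_def
  proof (rule sum.cong[OF refl])
    fix J assume "J \<in> Poly_Mapping.keys z"
    then have "mpar J = 1" using z(1) by (simp add: homog_def)
    then have "ser (fps_X * a1, 0, fps_X * a3, 0) J = ser (0, 0, fps_X * a3, 0) J"
      by (cases J rule: mono_cases) simp_all
    then show "Poly_Mapping.lookup z J * ser (fps_X * a1, 0, fps_X * a3, 0) J =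
        Poly_Mapping.lookup z J * ser (0, 0, fps_X * a3, 0) J" by simp
  qed
  also have "\<dots> = ev2 (ser (0, 0, 1, 0)) (ser (fps_X * a3, 0, 0, 0)) (comult z)"
    by (subst ev2_comult_ser) simp_all
  also have "\<dots> = ev (ser a) 0" by (simp add: z(2) ev2_def)
  finally show "ev (ser a) (coder (psi (0, 0, 1) W1) z) = ev (ser a) 0" .
qed

lemma not_equivalent_both:
  fixes d :: "'k::field_char_0 cochain"
  shows "\<not> (equivalent d (psi (0, 1, 0) W3) \<and> equivalent d (psi (0, 0, 1) W1))"
proof
  let ?\<psi> = "psi (0, 1, 0) W3 :: 'k cochain" and ?\<psi>' = "psi (0, 0, 1) W1 :: 'k cochain"
  assume "equivalent d ?\<psi> \<and> equivalent d ?\<psi>'"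
  then obtain g g' where g: "coalgebra_automorphism g" "coder ?\<psi> = inv g \<circ> coder d \<circ> g"
    and g': "coalgebra_automorphism g'" "coder ?\<psi>' = inv g' \<circ> coder d \<circ> g'"
    by (auto simp: equivalent_def)
  let ?x = "basis (mono3 0 (Suc 0) 0) :: 'k symW"
  \<comment> \<open>This is w_2 carried over to the second normal form; automorphisms keep it odd
    and primitive.\<close>
  define z where "z = inv g' (g ?x)"
  note i = automorphism_inv[OF g(1)] automorphism_inv[OF g'(1)]
  have lin: "lin g'" "lin (inv g)" and bij: "bij g'"
    using g'(1) i by (auto simp: coalgebra_automorphism_def)
  have "comult ?x = 0"
  proof (rule ev2_ser_eqI)
    fix a b :: "'k sps" assume ab: "a \<in> reduced" "b \<in> reduced"
    obtain a0 a1 a2 a3 b0 b1 b2 b3 where "a = (a0, a1, a2, a3)" "b = (b0, b1, b2, b3)"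
      by (metis prod_cases4)
    with ab show "ev2 (ser a) (ser b) (comult ?x) = ev2 (ser a) (ser b) 0"
      unfolding ev2_comult_ser[OF ab] by (simp add: ev2_def)
  qed
  moreover have "tensor_map u v 0 = 0" for u v :: "'k symW \<Rightarrow> 'k symW"
    by (simp add: tensor_map_def lin_zero[OF lin_lin_ext])
  ultimately have "comult z = 0"
    using g(1) i(2) by (simp add: z_def coalgebra_automorphism_def)
  moreover have "z \<in> homog mpar 1"
  proof -
    have "?x \<in> homog mpar 1" by (simp add: homog_def)
    then have "g ?x \<in> homog mpar 1"
      using g(1) unfolding coalgebra_automorphism_def has_parity_def by (metis add.right_neutral)
    then show ?thesis
      using i(2) unfolding z_def coalgebra_automorphism_def has_parity_def
      by (metis add.right_neutral)
  qed
  ultimately have "coder ?\<psi>' z = 0" by (simp only: coder_psi2_odd_primitive)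
  then have "inv g' (coder d (g' z)) = 0" by (simp only: g'(2) o_apply)
  moreover have "g' z = g ?x" using bij by (simp add: z_def bij_is_surj surj_f_inv_f)
  ultimately have "inv g' (coder d (g ?x)) = 0" by simp
  then have "coder d (g ?x) = 0"
    by (metis bij bij_is_surj lin(1) lin_zero surj_f_inv_f)
  then have "coder ?\<psi> ?x = 0" by (simp only: g(2) o_apply lin_zero[OF lin(2)])
  \<comment> \<open>\<open>fps_X\<close> is the coordinate dual to w_3, the image of w_2 under the
    first normal form.\<close>
  moreover have "ev (ser (fps_X, 0, 0, 0)) (coder ?\<psi> ?x) = 1"
    by (subst ev_coder_ser[OF represents_psi1]) simp_all
  ultimately show False by simp
qed

theorem mainTheorem1:
  fixes d :: "'k::{alg_closed_field, field_char_0} cochain"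
  assumes "codifferential d"
    and "component 1 d \<noteq> (\<lambda>_. 0)"
  shows "(equivalent d (psi (0, 1, 0) W3) \<or> equivalent d (psi (0, 0, 1) W1)) \<and>
    \<not> (equivalent d (psi (0, 1, 0) W3) \<and> equivalent d (psi (0, 0, 1) W1))"
proof
  have "lin d" "has_parity mpar gpar 1 d" using assms(1) by (simp_all add: codifferential_def)
  then obtain P where "represents P d" using represents_exists by blast
  then obtain p1 p2 q1 q2 r1 r2 where P: "represents (p1, p2, q1, q2, r1, r2) d"
    by (cases P) auto
  consider "fps_nth r1 0 \<noteq> 0 \<or> fps_nth r2 0 \<noteq> 0" | "fps_nth p1 1 \<noteq> 0" | "fps_nth p2 1 \<noteq> 0"
    using component_1_eq_0[OF P] assms(2) by blast
  then show "equivalent d (psi (0, 1, 0) W3) \<or> equivalent d (psi (0, 0, 1) W1)"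
    by cases (use equivalent_psi1_of_unit[OF assms(1) P] equivalent_psi2_fst[OF assms(1) P]
      equivalent_psi2_snd[OF assms(1) P] in blast)+
qed (rule not_equivalent_both)

end
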